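(* Let $\mathcal{F}=\{H_1,\ldots,H_{27}\}$ be the explicit set of 27 graphs listed in the context. A graph $G$ is sum-perfect if and only if it is $\mathcal{F}$-free, i.e. if and only if $G$ does not contain any of the graphs $H_1,\ldots,H_{27}$ as an induced subgraph.
   Context: All graphs are simple, finite, and undirected. For a graph $G$, $\alpha(G)$ is the stability number (maximum size of a stable set, i.e. a set of pairwise non-adjacent vertices), $\omega(G)$ is the clique number (maximum size of a clique), and $\overline{G}$ is the complement of $G$. A graph $G$ is sum-perfect if every induced subgraph $H$ of $G$ (including $G$ itself) satisfies $\alpha(H)+\omega(H)\geq |V(H)|$. For a set $\mathcal{L}$ of graphs, a graph $G$ is $\mathcal{L}$-free if no induced subgraph of $G$ is isomorphic to a graph in $\mathcal{L}$. The set $\mathcal{F}=\{H_1,\ldots,H_{27}\}$ is as follows. - $H_1=C_5$, the 5-cycle. - $H_2,\ldots,H_{13}$ are (up to isomorphism) all the bipartite graphs on 6 vertices that contain a perfect matching. Explicitly, on the vertex set $\{0,1,2,3,4,5\}$, writing $ij$ for the edge $\{i,j\}$, their edge sets are: $H_2=3K_2$: $03,14,25$; $H_3=P_4+K_2$: $03,05,14,25$; $H_4$: $03,05,14,15,25$; $H_5=C_4+K_2$: $03,14,15,24,25$; $H_6=P_6$: $03,05,14,15,24$; $H_7$: $03,05,14,15,24,25$; $H_8=C_6$: $03,04,13,15,24,25$; $H_9$: $03,04,05,14,15,25$; $H_{10}$: $03,04,05,13,15,24,25$; $H_{11}$: $03,04,05,13,14,15,25$; $H_{12}=K_{3,3}-e$: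 $03,04,05,13,14,15,24,25$; $H_{13}=K_{3,3}$: $03,04,05,13,14,15,23,24,25$. - $H_i=\overline{H_{i-12}}$ for $i\in\{14,\ldots,25\}$. - $H_{26}$ is the graph on vertex set $\{0,1,2,3,4,5,6\}$ with edges $03,05,06,14,15,24,26,45,46,56$. - $H_{27}=\overline{H_{26}}$. (Here $P_n$ is the path on $n$ vertices, $C_n$ the cycle on $n$ vertices, $K_n$ the complete graph on $n$ vertices, $G+H$ denotes disjoint union, and $nG$ denotes the disjoint union of $n$ copies of $G$.) *)

theory Defs
  imports "HOL-Library.Ramsey"
begin

text \<open>
  Graphs are finite, simple and undirected: a finite vertex set together with a set of
  two-element subsets of it. The null graph is admitted. The predicates \<^const>\<open>clique\<close>
  and \<^const>\<open>indep\<close> from \<^theory>\<open>HOL-Library.Ramsey\<close> take the candidate vertex set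
  first and the edge set second.
\<close>

type_synonym 'a graph = "'a set \<times> 'a set set"

abbreviation verts :: "'a graph \<Rightarrow> 'a set" where "verts \<equiv> fst"
abbreviation edges :: "'a graph \<Rightarrow> 'a set set" where "edges \<equiv> snd"

definition simple_graph :: "'a graph \<Rightarrow> bool" where
  "simple_graph G \<longleftrightarrow> finite (verts G) \<and> edges G \<subseteq> [verts G]\<^bsup>2\<^esup>"

definition complement :: "'a graph \<Rightarrow> 'a graph" where
  "complement G = (verts G, [verts G]\<^bsup>2\<^esup> - edges G)"

definition induced :: "'a graph \<Rightarrow> 'a set \<Rightarrow> 'a graph" where
  "induced G W = (W, {e \<in> edges G. e \<subseteq> W})"

definition stability_number :: "'a graph \<Rightarrow> nat" where
  "stability_number G = Max {card S |S. S \<subseteq> verts G \<and> indep S (edges G)}"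

definition clique_number :: "'a graph \<Rightarrow> nat" where
  "clique_number G = Max {card K |K. K \<subseteq> verts G \<and> clique K (edges G)}"

definition sum_perfect :: "'a graph \<Rightarrow> bool" where
  "sum_perfect G \<longleftrightarrow>
     (\<forall>W \<subseteq> verts G.
        stability_number (induced G W) + clique_number (induced G W)
          \<ge> card (verts (induced G W)))"

definition isomorphic :: "'a graph \<Rightarrow> 'b graph \<Rightarrow> bool" where
  "isomorphic G H \<longleftrightarrow>
     (\<exists>f. bij_betw f (verts G) (verts H) \<and>
          (\<forall>u \<in> verts G. \<forall>v \<in> verts G. {u, v} \<in> edges G \<longleftrightarrow> {f u, f v} \<in> edges H))"

definition is_free_of :: "'b graph set \<Rightarrow> 'a graph \<Rightarrow> bool" where
  "is_free_of L G \<longleftrightarrow> \<not> (\<exists>W \<subseteq> verts G. \<exists>H \<in> L. isomorphic (induced G W) H)"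

definition edge_list_graph :: "nat \<Rightarrow> (nat \<times> nat) list \<Rightarrow> nat graph" where
  "edge_list_graph n es = ({..<n}, {{i, j} |i j. (i, j) \<in> set es})"

text \<open>The cycle \<open>C\<^sub>5\<close>.\<close>

definition H1 :: "nat graph" where
  "H1 = edge_list_graph 5 [(0,1), (1,2), (2,3), (3,4), (0,4)]"

text \<open>
  The bipartite graphs on six vertices that contain a perfect matching, up to isomorphism.
  Among them are
  \<open>H2 = 3K\<^sub>2\<close>,
  \<open>H3 = P\<^sub>4 + K\<^sub>2\<close>,
  \<open>H5 = C\<^sub>4 + K\<^sub>2\<close>,
  \<open>H6 = P\<^sub>6\<close>,
  \<open>H8 = C\<^sub>6\<close>,
  \<open>H12 = K\<^bsub>3,3\<^esub> - e\<close>,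
  \<open>H13 = K\<^bsub>3,3\<^esub>\<close>.
\<close>

definition H2 :: "nat graph" where
  "H2 = edge_list_graph 6 [(0,3), (1,4), (2,5)]"

definition H3 :: "nat graph" where
  "H3 = edge_list_graph 6 [(0,3), (0,5), (1,4), (2,5)]"

definition H4 :: "nat graph" where
  "H4 = edge_list_graph 6 [(0,3), (0,5), (1,4), (1,5), (2,5)]"

definition H5 :: "nat graph" where
  "H5 = edge_list_graph 6 [(0,3), (1,4), (1,5), (2,4), (2,5)]"

definition H6 :: "nat graph" where
  "H6 = edge_list_graph 6 [(0,3), (0,5), (1,4), (1,5), (2,4)]"

definition H7 :: "nat graph" where
  "H7 = edge_list_graph 6 [(0,3), (0,5), (1,4), (1,5), (2,4), (2,5)]"

definition H8 :: "nat graph" where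
  "H8 = edge_list_graph 6 [(0,3), (0,4), (1,3), (1,5), (2,4), (2,5)]"

definition H9 :: "nat graph" where
  "H9 = edge_list_graph 6 [(0,3), (0,4), (0,5), (1,4), (1,5), (2,5)]"

definition H10 :: "nat graph" where
  "H10 = edge_list_graph 6 [(0,3), (0,4), (0,5), (1,3), (1,5), (2,4), (2,5)]"

definition H11 :: "nat graph" where
  "H11 = edge_list_graph 6 [(0,3), (0,4), (0,5), (1,3), (1,4), (1,5), (2,5)]"

definition H12 :: "nat graph" where
  "H12 = edge_list_graph 6 [(0,3), (0,4), (0,5), (1,3), (1,4), (1,5), (2,4), (2,5)]"

definition H13 :: "nat graph" where
  "H13 = edge_list_graph 6 [(0,3), (0,4), (0,5), (1,3), (1,4), (1,5), (2,3), (2,4), (2,5)]"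

definition H26 :: "nat graph" where
  "H26 = edge_list_graph 7 [(0,3), (0,5), (0,6), (1,4), (1,5), (2,4), (2,6), (4,5), (4,6), (5,6)]"

text \<open>
  The complement of \<open>H1\<close> does not appear separately, since \<open>C\<^sub>5\<close> is self-complementary.
\<close>

definition bipartite_matching_graphs :: "nat graph set" where
  "bipartite_matching_graphs = {H2, H3, H4, H5, H6, H7, H8, H9, H10, H11, H12, H13}"

definition forbidden_graphs :: "nat graph set" where
  "forbidden_graphs =
     {H1} \<union> bipartite_matching_graphs \<union> complement ` bipartite_matching_graphs
       \<union> {H26, complement H26}"

lemma simple_graph_complement:
  "simple_graph G \<Longrightarrow> simple_graph (complement G)"
  by (auto simp: simple_graph_def complement_def)

lemma simple_graph_induced:
  "simple_graph G \<Longrightarrow> W \<subseteq> verts G \<Longrightarrow> simple_graph (induced G W)"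
  by (auto simp: simple_graph_def induced_def nsets_def intro: finite_subset)

lemma simple_graph_edge_list_graph:
  assumes "\<forall>(i, j) \<in> set es. i < n \<and> j < n \<and> i \<noteq> j"
  shows "simple_graph (edge_list_graph n es)"
  using assms by (fastforce simp: simple_graph_def edge_list_graph_def nsets_def)

lemma simple_graph_forbidden_graphs:
  assumes "H \<in> forbidden_graphs"
  shows "simple_graph H"
proof -
  have base: "simple_graph H" if "H \<in> {H1, H26} \<union> bipartite_matching_graphs" for H
    using that unfolding bipartite_matching_graphs_def
    by (auto simp: H1_def H2_def H3_def H4_def H5_def H6_def H7_def H8_def H9_def H10_def
        H11_def H12_def H13_def H26_def intro!: simple_graph_edge_list_graph)
  then show ?thesis
    using assms unfolding forbidden_graphs_def by (blast intro: base simple_graph_complement)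
qed

end

theory Submission
  imports Defs
begin

text \<open>
  That a sum-perfect graph contains no forbidden graph holds because each forbidden graph violates
  \<open>\<alpha> + \<omega> \<ge> n\<close>, as clique covers and colourings show.

  For the converse, consider a graph without forbidden induced subgraphs that is not sum-perfect and
  has as few vertices as possible. It is critical (\<open>exists_critical_graph\<close>): \<open>n = \<alpha> + \<omega> + 1\<close>, and every
  vertex is avoided by some maximum stable set and by some maximum clique. The complement is critical
  too. The excluded bipartite graphs enter through the following observation. By Hall's theorem, two
  maximum stable sets \<open>A\<close>, \<open>B\<close> have a perfect matching between \<open>A - B\<close> and \<open>B - A\<close>
  (\<open>max_stable_matching\<close>), and three of its edges would span one of \<open>H2\<close>, ..., \<open>H13\<close>; so maximum stable
  sets differ in at most two vertices (\<open>max_stable_diff_le_two\<close>).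

  Since no vertex lies in all maximum stable sets, this rigidity forces, when \<open>\<alpha> \<ge> 3\<close>, a maximum stable
  set \<open>A\<close> in which every vertex \<open>x\<close> has a private neighbour \<open>p x\<close> (\<open>exists_private_neighbours\<close>). Any two
  private neighbours are adjacent, as otherwise three pairs \<open>x\<close>, \<open>p x\<close> would again span a bipartite graph
  with a perfect matching. So \<open>p ` A\<close> is a clique and \<open>\<omega> \<ge> \<alpha>\<close>; by complementation, \<open>\<alpha> = \<omega>\<close>. Now
  \<open>n = 2 \<alpha> + 1\<close>, and the graph is \<open>A\<close> and \<open>p ` A\<close> plus a single vertex \<open>v\<close>. If \<open>\<alpha> \<ge> 4\<close>, criticality for
  cliques makes \<open>v\<close> complete to \<open>p ` A\<close>, which is absurd. If \<open>\<alpha> = 3\<close>, the graph is a net plus one vertex,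
  and a short case analysis ends in \<open>H26\<close> or its complement. What remains is \<open>\<alpha> = \<omega> = 2\<close> and \<open>n = 5\<close>,
  where the pentagon \<open>H1\<close> appears.
\<close>

section \<open>Stability and clique numbers\<close>

definition max_stable :: "'a graph \<Rightarrow> 'a set \<Rightarrow> bool" where
  "max_stable G S \<longleftrightarrow>
     S \<subseteq> verts G \<and> indep S (edges G) \<and> card S = stability_number G"

definition max_clique :: "'a graph \<Rightarrow> 'a set \<Rightarrow> bool" where
  "max_clique G K \<longleftrightarrow>
     K \<subseteq> verts G \<and> clique K (edges G) \<and> card K = clique_number G"

lemma indep_insert:
  "indep (insert v S) E \<longleftrightarrow> indep S E \<and> (\<forall>u\<in>S. u \<noteq> v \<longrightarrow> {u, v} \<notin> E)"
  by (auto simp: indep_def insert_commute)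

lemma clique_insert:
  "clique (insert v S) E \<longleftrightarrow> clique S E \<and> (\<forall>u\<in>S. u \<noteq> v \<longrightarrow> {u, v} \<in> E)"
  by (auto simp: clique_def insert_commute)

lemma edge_in_complement_iff:
  assumes "u \<in> verts G" "v \<in> verts G" "u \<noteq> v"
  shows "{u, v} \<in> edges (complement G) \<longleftrightarrow> {u, v} \<notin> edges G"
  using assms by (auto simp: complement_def nsets_def)

lemma verts_complement [simp]: "verts (complement G) = verts G"
  by (simp add: complement_def)

lemma complement_complement: "simple_graph G \<Longrightarrow> complement (complement G) = G"
  by (cases G) (auto simp: simple_graph_def complement_def)

lemma indep_complement_iff:
  "S \<subseteq> verts G \<Longrightarrow> indep S (edges (complement G)) \<longleftrightarrow> clique S (edges G)"
  unfolding indep_def clique_def using edge_in_complement_iff[of _ G] by blast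

lemma clique_complement_iff:
  "S \<subseteq> verts G \<Longrightarrow> clique S (edges (complement G)) \<longleftrightarrow> indep S (edges G)"
  unfolding indep_def clique_def using edge_in_complement_iff[of _ G] by blast

lemma stability_number_complement: "stability_number (complement G) = clique_number G"
proof -
  have "{card S |S. S \<subseteq> verts (complement G) \<and> indep S (edges (complement G))} =
        {card S |S. S \<subseteq> verts G \<and> clique S (edges G)}"
    by (auto simp: indep_complement_iff)
  then show ?thesis by (simp add: stability_number_def clique_number_def)
qed

lemma clique_number_complement: "clique_number (complement G) = stability_number G"
proof -
  have "{card S |S. S \<subseteq> verts (complement G) \<and> clique S (edges (complement G))} =
        {card S |S. S \<subseteq> verts G \<and> indep S (edges G)}"
    by (auto simp: clique_complement_iff)
  then show ?thesis by (simp add: stability_number_def clique_number_def)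
qed

lemma max_stable_complement: "max_stable (complement G) S \<longleftrightarrow> max_clique G S"
  by (auto simp: max_stable_def max_clique_def indep_complement_iff stability_number_complement)

lemma max_clique_complement: "max_clique (complement G) S \<longleftrightarrow> max_stable G S"
  by (auto simp: max_stable_def max_clique_def clique_complement_iff clique_number_complement)

lemma card_stable_le:
  assumes "finite (verts G)" "S \<subseteq> verts G" "indep S (edges G)"
  shows "card S \<le> stability_number G"
  unfolding stability_number_def using assms by (intro Max_ge) auto

lemma card_clique_le:
  assumes "finite (verts G)" "K \<subseteq> verts G" "clique K (edges G)"
  shows "card K \<le> clique_number G"
  using card_stable_le[of "complement G" K] assms
  by (simp add: indep_complement_iff stability_number_complement)

lemma max_stable_exists:
  assumes "finite (verts G)"
  shows "\<exists>S. max_stable G S"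
proof -
  let ?C = "{card S |S. S \<subseteq> verts G \<and> indep S (edges G)}"
  have "card {} \<in> ?C" by force
  then have "Max ?C \<in> ?C" using assms by (intro Max_in) auto
  then show ?thesis by (auto simp: max_stable_def stability_number_def)
qed

lemma max_clique_exists:
  assumes "finite (verts G)"
  shows "\<exists>K. max_clique G K"
  using max_stable_exists[of "complement G"] assms by (simp add: max_stable_complement)

text \<open>
  A stable set meets each clique in at most one vertex, so choosing for every vertex of a maximum
  stable set a covering clique is injective.
\<close>

lemma stability_number_le_clique_cover:
  assumes fin: "finite (verts G)" "finite \<C>"
    and cover: "verts G \<subseteq> \<Union>\<C>" and cliques: "\<forall>C\<in>\<C>. clique C (edges G)"
  shows "stability_number G \<le> card \<C>"
proof -
  obtain S where S: "S \<subseteq> verts G" "indep S (edges G)" "card S = stability_number G"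
    using max_stable_exists[OF fin(1)] by (auto simp: max_stable_def)
  have "\<forall>s\<in>S. \<exists>C. C \<in> \<C> \<and> s \<in> C" using S(1) cover by blast
  then obtain f where f: "\<forall>s\<in>S. f s \<in> \<C> \<and> s \<in> f s" by metis
  have "inj_on f S"
    using f S(2) cliques unfolding inj_on_def indep_def clique_def by metis
  then have "card S \<le> card \<C>"
    using f fin(2) by (intro card_inj_on_le) auto
  then show ?thesis using S by simp
qed

lemma clique_number_le_stable_cover:
  assumes fin: "finite (verts G)" "finite \<C>"
    and cover: "verts G \<subseteq> \<Union>\<C>" and stable: "\<forall>C\<in>\<C>. C \<subseteq> verts G \<and> indep C (edges G)"
  shows "clique_number G \<le> card \<C>"
  using stability_number_le_clique_cover[of "complement G" \<C>] assms
  by (simp add: clique_complement_iff stability_number_complement)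


section \<open>Induced subgraphs and isomorphism\<close>

lemma verts_induced [simp]: "verts (induced G W) = W"
  by (simp add: induced_def)

lemma edge_induced_iff: "u \<in> W \<Longrightarrow> v \<in> W \<Longrightarrow> {u, v} \<in> edges (induced G W) \<longleftrightarrow> {u, v} \<in> edges G"
  by (simp add: induced_def)

lemma induced_induced: "U \<subseteq> W \<Longrightarrow> induced (induced G W) U = induced G U"
  by (auto simp: induced_def)

lemma complement_induced: "W \<subseteq> verts G \<Longrightarrow> complement (induced G W) = induced (complement G) W"
  by (auto simp: induced_def complement_def nsets_def)

lemma indep_induced_iff: "S \<subseteq> W \<Longrightarrow> indep S (edges (induced G W)) \<longleftrightarrow> indep S (edges G)"
  unfolding indep_def by (auto simp: induced_def)

lemma clique_induced_iff: "K \<subseteq> W \<Longrightarrow> clique K (edges (induced G W)) \<longleftrightarrow> clique K (edges G)"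
  unfolding clique_def by (auto simp: induced_def)

lemma stability_number_induced_mono:
  assumes "finite W" "U \<subseteq> W"
  shows "stability_number (induced G U) \<le> stability_number (induced G W)"
proof -
  have "finite U" using assms by (rule rev_finite_subset)
  then obtain S where S: "S \<subseteq> U" "indep S (edges (induced G U))"
      "card S = stability_number (induced G U)"
    using max_stable_exists[of "induced G U"] by (auto simp: max_stable_def)
  have "card S \<le> stability_number (induced G W)"
    using S assms by (intro card_stable_le) (auto simp: indep_induced_iff)
  then show ?thesis using S by simp
qed

lemma clique_number_induced_mono:
  assumes "finite W" "U \<subseteq> W" "W \<subseteq> verts G"
  shows "clique_number (induced G U) \<le> clique_number (induced G W)"
  using stability_number_induced_mono[OF assms(1,2), of "complement G"] assms
  by (metis complement_induced stability_number_complement subset_trans)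

lemma isomorphic_trans: "isomorphic A B \<Longrightarrow> isomorphic B C \<Longrightarrow> isomorphic A C"
  unfolding isomorphic_def
proof (elim exE conjE)
  fix f g
  assume f: "bij_betw f (verts A) (verts B)" and g: "bij_betw g (verts B) (verts C)"
    and ef: "\<forall>u\<in>verts A. \<forall>v\<in>verts A. ({u, v} \<in> edges A) = ({f u, f v} \<in> edges B)"
    and eg: "\<forall>u\<in>verts B. \<forall>v\<in>verts B. ({u, v} \<in> edges B) = ({g u, g v} \<in> edges C)"
  have "f u \<in> verts B" if "u \<in> verts A" for u using f that by (auto simp: bij_betw_def)
  then show "\<exists>h. bij_betw h (verts A) (verts C) \<and>
      (\<forall>u\<in>verts A. \<forall>v\<in>verts A. ({u, v} \<in> edges A) = ({h u, h v} \<in> edges C))"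
    using bij_betw_trans[OF f g] ef eg by (intro exI[of _ "g \<circ> f"]) auto
qed

lemma isomorphic_complement:
  assumes iso: "isomorphic A B" and simple: "simple_graph A" "simple_graph B"
  shows "isomorphic (complement A) (complement B)"
proof -
  obtain f where f: "bij_betw f (verts A) (verts B)"
    and e: "\<forall>u\<in>verts A. \<forall>v\<in>verts A. ({u, v} \<in> edges A) = ({f u, f v} \<in> edges B)"
    using iso by (auto simp: isomorphic_def)
  have "({u, v} \<in> edges (complement A)) = ({f u, f v} \<in> edges (complement B))"
    if uv: "u \<in> verts A" "v \<in> verts A" for u v
  proof (cases "u = v")
    case True
    then show ?thesis by (simp add: complement_def nsets_def)
  next
    case False
    then have "f u \<noteq> f v" "f u \<in> verts B" "f v \<in> verts B"
      using f uv by (auto simp: bij_betw_def inj_on_def)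
    then show ?thesis using False uv e by (simp add: edge_in_complement_iff)
  qed
  then show ?thesis using f unfolding isomorphic_def by auto
qed

lemma stability_number_isomorphic_le:
  assumes "finite (verts A)" "finite (verts B)" "isomorphic A B"
  shows "stability_number A \<le> stability_number B"
proof -
  obtain f where f: "inj_on f (verts A)" "f ` verts A = verts B"
    and e: "\<forall>u\<in>verts A. \<forall>v\<in>verts A. ({u, v} \<in> edges A) = ({f u, f v} \<in> edges B)"
    using assms by (auto simp: isomorphic_def bij_betw_def)
  obtain S where S: "S \<subseteq> verts A" "indep S (edges A)" "card S = stability_number A"
    using max_stable_exists[OF assms(1)] by (auto simp: max_stable_def)
  have "{f u, f v} \<notin> edges B" if "u \<in> S" "v \<in> S" "f u \<noteq> f v" for u v
  proof -
    have "u \<noteq> v" "u \<in> verts A" "v \<in> verts A" using that S(1) by auto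
    moreover have "{u, v} \<notin> edges A" using that S(2) by (auto simp: indep_def)
    ultimately show ?thesis using e by simp
  qed
  then have "indep (f ` S) (edges B)" by (auto simp: indep_def)
  then have "card (f ` S) \<le> stability_number B"
    using S f assms by (intro card_stable_le) auto
  then show ?thesis using S f by (metis card_image inj_on_subset)
qed

lemma clique_number_isomorphic_le:
  assumes "simple_graph A" "simple_graph B" "isomorphic A B"
  shows "clique_number A \<le> clique_number B"
  using stability_number_isomorphic_le[OF _ _ isomorphic_complement[OF assms(3,1,2)]] assms
  by (simp add: stability_number_complement simple_graph_def)

lemma is_free_of_induced:
  assumes "is_free_of L G" "W \<subseteq> verts G"
  shows "is_free_of L (induced G W)"
  using assms unfolding is_free_of_def by (auto simp: induced_induced)


lemma card_pair_le: "card {a, b} \<le> 2" and card_triple_le: "card {a, b, c} \<le> 3"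
  by (simp_all add: card_insert_if)

section \<open>The forbidden graphs are not sum-perfect\<close>

lemma edge_in_edge_list_graph_iff:
  "{i, j} \<in> edges (edge_list_graph n es) \<longleftrightarrow> (i, j) \<in> set es \<or> (j, i) \<in> set es"
  by (auto simp: edge_list_graph_def doubleton_eq_iff)

lemma singleton_not_edge_list_graph_iff:
  "{i} \<in> edges (edge_list_graph n es) \<longleftrightarrow> (i, i) \<in> set es"
  using edge_in_edge_list_graph_iff[of i i] by simp

lemma verts_edge_list_graph [simp]: "verts (edge_list_graph n es) = {..<n}"
  by (simp add: edge_list_graph_def)

text \<open>
  Doubling modulo 5 sends the chords of the pentagon to its sides. This is what makes the list of
  forbidden graphs closed under complement up to isomorphism, although the complement of \<open>C\<^sub>5\<close>
  is not listed.
\<close>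

lemma complement_H1_isomorphic: "isomorphic (complement H1) H1"
proof -
  let ?f = "\<lambda>i::nat. 2 * i mod 5"
  have V: "verts H1 = {0, 1, 2, 3, 4}" by (auto simp: H1_def)
  have "bij_betw ?f (verts (complement H1)) (verts H1)"
    by (auto simp: V bij_betw_def inj_on_def)
  moreover have "\<forall>u\<in>verts H1. \<forall>v\<in>verts H1.
      {u, v} \<in> edges (complement H1) \<longleftrightarrow> {?f u, ?f v} \<in> edges H1"
    unfolding V
    by (simp add: complement_def V nsets_def)
      (simp add: H1_def edge_in_edge_list_graph_iff singleton_not_edge_list_graph_iff)
  ultimately show ?thesis unfolding isomorphic_def by auto
qed

lemma complement_forbidden:
  assumes "H \<in> forbidden_graphs"
  shows "\<exists>H' \<in> forbidden_graphs. isomorphic (complement H) H'"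
proof (cases "H = H1")
  case True
  then show ?thesis using complement_H1_isomorphic by (auto simp: forbidden_graphs_def)
next
  case False
  have "simple_graph K" if "K \<in> bipartite_matching_graphs \<or> K = H26" for K
    using that by (intro simple_graph_forbidden_graphs) (auto simp: forbidden_graphs_def)
  then have "complement (complement K) = K" if "K \<in> bipartite_matching_graphs \<or> K = H26" for K
    using that by (intro complement_complement)
  then have "complement H \<in> forbidden_graphs"
    using assms False unfolding forbidden_graphs_def by fastforce
  moreover have "isomorphic (complement H) (complement H)"
    unfolding isomorphic_def by (intro exI[of _ id]) auto
  ultimately show ?thesis by blast
qed

lemma is_free_of_forbidden_complement:
  assumes "simple_graph G" "is_free_of forbidden_graphs G"
  shows "is_free_of forbidden_graphs (complement G)"
  unfolding is_free_of_def
proof (intro notI, elim exE bexE conjE)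
  fix W H
  assume W: "W \<subseteq> verts (complement G)" and H: "H \<in> forbidden_graphs"
    and iso: "isomorphic (induced (complement G) W) H"
  have ind: "simple_graph (induced (complement G) W)"
    using assms(1) W by (intro simple_graph_induced simple_graph_complement)
  have "complement (induced (complement G) W) = induced G W"
    using W assms(1) complement_complement complement_induced by metis
  with isomorphic_complement[OF iso ind simple_graph_forbidden_graphs[OF H]]
  have "isomorphic (induced G W) (complement H)" by simp
  then show False
    using complement_forbidden[OF H] isomorphic_trans assms(2) W unfolding is_free_of_def
    by (metis verts_complement)
qed

text \<open>
  The three matching edges cover the vertices by cliques, so \<open>\<alpha> \<le> 3\<close>, and the two sides cover them by
  stable sets, so \<open>\<omega> \<le> 2\<close>.
\<close>

lemma matched_six_not_sum_perfect:
  assumes V: "verts H = {..<6}"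
    and \<pi>: "distinct [i, j, k]" "{i, j, k} = {3, 4, 5::nat}"
    and matched: "{0, i} \<in> edges H" "{1, j} \<in> edges H" "{2, k} \<in> edges H"
    and sides: "indep {0, 1, 2} (edges H)" "indep {3, 4, 5} (edges H)"
  shows "stability_number H + clique_number H < card (verts H)"
proof -
  have six: "{..<6} = {0, 1, 2, 3, 4, 5::nat}" by auto
  have "stability_number H \<le> card {{0, i}, {1, j}, {2, k}}"
    using matched \<pi>
    by (intro stability_number_le_clique_cover) (auto simp: V six clique_def insert_commute)
  also have "\<dots> \<le> 3" by (rule card_triple_le)
  finally have "stability_number H \<le> 3" .
  have "clique_number H \<le> card {{0, 1, 2}, {3, 4, 5::nat}}"
    using sides by (intro clique_number_le_stable_cover) (auto simp: V six)
  also have "\<dots> \<le> 2" by (rule card_pair_le)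
  finally have "clique_number H \<le> 2" .
  with \<open>stability_number H \<le> 3\<close> show ?thesis by (simp add: V)
qed

lemma bipartite_matching_graph_not_sum_perfect:
  assumes "H \<in> bipartite_matching_graphs"
  shows "stability_number H + clique_number H < card (verts H)"
proof -
  have sides: "indep {0, 1, 2} (edges H)" "indep {3, 4, 5} (edges H)"
    using assms unfolding bipartite_matching_graphs_def
    by (auto simp: indep_def edge_in_edge_list_graph_iff H2_def H3_def H4_def H5_def H6_def H7_def
        H8_def H9_def H10_def H11_def H12_def H13_def)
  have V: "verts H = {..<6}"
    using assms unfolding bipartite_matching_graphs_def
    by (auto simp: H2_def H3_def H4_def H5_def H6_def H7_def H8_def H9_def H10_def
        H11_def H12_def H13_def)
  have straight: ?thesis if "{0, 3} \<in> edges H" "{1, 4} \<in> edges H" "{2, 5} \<in> edges H"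
    using matched_six_not_sum_perfect[OF V _ _ that sides] by simp
  have crossed: ?thesis if "{0, 3} \<in> edges H" "{1, 5} \<in> edges H" "{2, 4} \<in> edges H"
  proof (rule matched_six_not_sum_perfect[OF V _ _ that sides])
    show "{3, 5, 4::nat} = {3, 4, 5}" by blast
  qed simp
  show ?thesis
    using assms straight crossed unfolding bipartite_matching_graphs_def
    by (auto simp: edge_in_edge_list_graph_iff H2_def H3_def H4_def H5_def H6_def H7_def
        H8_def H9_def H10_def H11_def H12_def H13_def)
qed

text \<open>
  Three cliques are needed to cover a pentagon, so a clique cover only gives \<open>\<alpha> \<le> 3\<close>; instead
  the vertices of a stable set are counted against the five edges, each of which contains at most
  one of them.
\<close>

lemma H1_not_sum_perfect: "stability_number H1 + clique_number H1 < card (verts H1)"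
proof -
  have fin: "finite (verts H1)" by (simp add: H1_def)
  have "card S \<le> 2" if S: "S \<subseteq> verts H1" "indep S (edges H1)" for S
  proof -
    have sub: "S \<subseteq> {0, 1, 2, 3, 4}" using S(1) by (auto simp: H1_def)
    have edge: "\<not> (i \<in> S \<and> j \<in> S)" if "(i, j) \<in> {(0,1), (1,2), (2,3), (3,4), (0,4)}" for i j
    proof -
      have "{i, j} \<in> edges H1" "i \<noteq> j"
        using that by (auto simp: H1_def edge_in_edge_list_graph_iff)
      then show ?thesis using S(2) unfolding indep_def by blast
    qed
    have "card S = (\<Sum>i\<in>{0, 1, 2, 3, 4}. if i \<in> S then 1 else 0)"
      using sub by (simp add: sum.If_cases Int_absorb1 flip: card_eq_sum)
    then show ?thesis
      using edge[of 0 1] edge[of 1 2] edge[of 2 3] edge[of 3 4] edge[of 0 4]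
      by (simp split: if_splits)
  qed
  then have \<alpha>: "stability_number H1 \<le> 2"
    using max_stable_exists[OF fin] unfolding max_stable_def by metis
  have "clique_number H1 \<le> stability_number H1"
    using stability_number_isomorphic_le[OF _ fin complement_H1_isomorphic] fin
    by (simp add: stability_number_complement)
  with \<alpha> show ?thesis by (simp add: H1_def)
qed

lemma H26_not_sum_perfect: "stability_number H26 + clique_number H26 < card (verts H26)"
proof -
  have seven: "{..<7} = {0, 1, 2, 3, 4, 5, 6::nat}" by auto
  \<comment> \<open>A clique cover and a proper colouring with three classes each.\<close>
  have "stability_number H26 \<le> card {{0, 3}, {1, 4, 5}, {2, 6::nat}}"
    by (intro stability_number_le_clique_cover)
      (auto simp: H26_def seven clique_def edge_in_edge_list_graph_iff)
  also have "\<dots> \<le> 3" by (rule card_triple_le)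
  finally have "stability_number H26 \<le> 3" .
  have "clique_number H26 \<le> card {{0, 4}, {1, 3, 6}, {2, 5::nat}}"
    by (intro clique_number_le_stable_cover)
      (auto simp: H26_def seven indep_def edge_in_edge_list_graph_iff)
  also have "\<dots> \<le> 3" by (rule card_triple_le)
  finally have "clique_number H26 \<le> 3" .
  with \<open>stability_number H26 \<le> 3\<close> show ?thesis by (simp add: H26_def)
qed

text \<open>
  Complementation swaps \<open>\<alpha>\<close> and \<open>\<omega>\<close>, so half of the list suffices.
\<close>

lemma forbidden_graph_not_sum_perfect:
  assumes "H \<in> forbidden_graphs"
  shows "stability_number H + clique_number H < card (verts H)"
proof -
  have *: "stability_number K + clique_number K < card (verts K)"
    if "K \<in> {H1, H26} \<union> bipartite_matching_graphs" for K
    using that H1_not_sum_perfect H26_not_sum_perfect bipartite_matching_graph_not_sum_perfect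
    by blast
  have "H \<in> {H1, H26} \<union> bipartite_matching_graphs \<or>
      (\<exists>K \<in> {H1, H26} \<union> bipartite_matching_graphs. H = complement K)"
    using assms unfolding forbidden_graphs_def by blast
  then show ?thesis
  proof (elim disjE bexE)
    fix K assume "K \<in> {H1, H26} \<union> bipartite_matching_graphs" "H = complement K"
    then show ?thesis
      using *[of K] by (simp add: stability_number_complement clique_number_complement add.commute)
  qed (rule *)
qed

lemma sum_perfect_imp_free:
  assumes G: "simple_graph G" and perfect: "sum_perfect G"
  shows "is_free_of forbidden_graphs G"
  unfolding is_free_of_def
proof (intro notI, elim exE bexE conjE)
  fix W H
  assume W: "W \<subseteq> verts G" and H: "H \<in> forbidden_graphs" and iso: "isomorphic (induced G W) H"
  have simple: "simple_graph (induced G W)" "simple_graph H"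
    using G W H by (auto intro: simple_graph_induced simple_graph_forbidden_graphs)
  then have "stability_number (induced G W) \<le> stability_number H"
      "clique_number (induced G W) \<le> clique_number H"
    using stability_number_isomorphic_le[OF _ _ iso] clique_number_isomorphic_le[OF _ _ iso]
    by (simp_all add: simple_graph_def)
  moreover have "card (verts (induced G W)) = card (verts H)"
    using iso by (auto simp: isomorphic_def intro: bij_betw_same_card)
  moreover have "card (verts (induced G W)) \<le>
      stability_number (induced G W) + clique_number (induced G W)"
    using perfect W by (simp add: sum_perfect_def)
  ultimately show False using forbidden_graph_not_sum_perfect[OF H] by linarith
qed


section \<open>Recognising forbidden induced subgraphs\<close>

text \<open>
  Listing the vertices of an induced subgraph as \<open>xs\<close> fixes an isomorphism to a graph on the
  positions of the list. Only pairs of positions \<open>i < j\<close> are compared, because the edge lists of the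
  forbidden graphs are written with increasing pairs; the ranges are lists so that, for an explicit
  \<open>xs\<close>, simplification unfolds the condition into finitely many adjacencies.
\<close>

definition represents :: "'a graph \<Rightarrow> 'a list \<Rightarrow> (nat \<times> nat) list \<Rightarrow> bool" where
  "represents G xs es \<longleftrightarrow>
     (\<forall>j\<in>set [0..<length xs]. \<forall>i\<in>set [0..<j]. {xs ! i, xs ! j} \<in> edges G \<longleftrightarrow> (i, j) \<in> set es)"

lemma not_represents:
  assumes simple: "simple_graph G" and free: "is_free_of L G"
    and L: "edge_list_graph n es \<in> L" and n: "length xs = n"
    and es: "\<forall>(i, j)\<in>set es. i < j"
    and xs: "distinct xs" "set xs \<subseteq> verts G"
  shows "\<not> represents G xs es"
proof
  assume rep: "represents G xs es"
  let ?H = "edge_list_graph (length xs) es"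
  let ?f = "the_inv_into {..<length xs} (\<lambda>i. xs ! i)"
  have b: "bij_betw (\<lambda>i. xs ! i) {..<length xs} (set xs)"
    by (rule bij_betw_nth) (use xs in auto)
  have f: "?f (xs ! i) = i" if "i < length xs" for i
    using b that by (auto simp: bij_betw_def the_inv_into_f_f)
  have less: "{xs ! i, xs ! j} \<in> edges G \<longleftrightarrow> {i, j} \<in> edges ?H"
    if "i < j" "j < length xs" for i j
  proof -
    have "(j, i) \<notin> set es" using es that by fastforce
    then show ?thesis
      using rep that by (auto simp: represents_def edge_in_edge_list_graph_iff)
  qed
  have edge: "{xs ! i, xs ! j} \<in> edges G \<longleftrightarrow> {i, j} \<in> edges ?H"
    if "i < length xs" "j < length xs" for i j
  proof (cases i j rule: linorder_cases)
    case equal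
    have "{xs ! i, xs ! i} \<notin> edges G"
      using simple by (auto simp: simple_graph_def nsets_def)
    moreover have "{i, i} \<notin> edges ?H"
      using es unfolding edge_in_edge_list_graph_iff by auto
    ultimately show ?thesis using equal by simp
  next
    case greater
    then show ?thesis using less[of j i] that by (simp add: insert_commute)
  qed (use that less in simp)
  have "isomorphic (induced G (set xs)) ?H"
    unfolding isomorphic_def
  proof (intro exI[of _ ?f] conjI ballI)
    show "bij_betw ?f (verts (induced G (set xs))) (verts ?H)"
      using bij_betw_the_inv_into[OF b] by simp
    fix u v assume "u \<in> verts (induced G (set xs))" "v \<in> verts (induced G (set xs))"
    then obtain i j where ij: "u = xs ! i" "v = xs ! j" "i < length xs" "j < length xs"
      by (auto simp: in_set_conv_nth)
    then show "({u, v} \<in> edges (induced G (set xs))) = ({?f u, ?f v} \<in> edges ?H)"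
      using edge f by (simp add: edge_induced_iff)
  qed
  then show False using free L n xs(2) unfolding is_free_of_def by blast
qed

text \<open>
  The edge lists of \<open>H2\<close>, ..., \<open>H13\<close> as data, to be searched.
\<close>

definition bipartite_matching_lists :: "(nat \<times> nat) list list" where
  "bipartite_matching_lists =
    [[(0,3), (1,4), (2,5)],
     [(0,3), (0,5), (1,4), (2,5)],
     [(0,3), (0,5), (1,4), (1,5), (2,5)],
     [(0,3), (1,4), (1,5), (2,4), (2,5)],
     [(0,3), (0,5), (1,4), (1,5), (2,4)],
     [(0,3), (0,5), (1,4), (1,5), (2,4), (2,5)],
     [(0,3), (0,4), (1,3), (1,5), (2,4), (2,5)],
     [(0,3), (0,4), (0,5), (1,4), (1,5), (2,5)],
     [(0,3), (0,4), (0,5), (1,3), (1,5), (2,4), (2,5)],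
     [(0,3), (0,4), (0,5), (1,3), (1,4), (1,5), (2,5)],
     [(0,3), (0,4), (0,5), (1,3), (1,4), (1,5), (2,4), (2,5)],
     [(0,3), (0,4), (0,5), (1,3), (1,4), (1,5), (2,3), (2,4), (2,5)]]"

lemma bipartite_matching_graphs_eq:
  "bipartite_matching_graphs = edge_list_graph 6 ` set bipartite_matching_lists"
  by (simp add: bipartite_matching_graphs_def bipartite_matching_lists_def H2_def H3_def H4_def
      H5_def H6_def H7_def H8_def H9_def H10_def H11_def H12_def H13_def)

lemma bipartite_matching_lists_between_sides:
  "es \<in> set bipartite_matching_lists \<Longrightarrow> (i, j) \<in> set es \<Longrightarrow> i < 3 \<and> 3 \<le> j \<and> j < 6"
  by (auto simp: bipartite_matching_lists_def)

text \<open>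
  \<open>M\<close> is the 3 by 3 biadjacency matrix of a bipartite graph; permuting its rows by \<open>p\<close> and its
  columns by \<open>q\<close> must give the biadjacency matrix of the graph with edge list \<open>es\<close>, whose second
  side is numbered from 3.
\<close>

definition realises :: "bool list list \<Rightarrow> (nat \<times> nat) list \<Rightarrow> nat list \<Rightarrow> nat list \<Rightarrow> bool" where
  "realises M es p q \<longleftrightarrow>
     (\<forall>i\<in>{0,1,2}. \<forall>j\<in>{0,1,2}. (i, j + 3) \<in> set es \<longleftrightarrow> M ! (p ! i) ! (q ! j))"

definition perms3 :: "nat list list" where
  "perms3 = [[0,1,2], [0,2,1], [1,0,2], [1,2,0], [2,0,1], [2,1,0]]"

text \<open>
  The classification behind the list: a bipartite graph on 3 + 3 vertices with a perfect matching
  has, after numbering matched vertices alike, a biadjacency matrix with diagonal \<open>True\<close>. Each of the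
  64 such matrices is, up to permuting rows and columns and exchanging the sides (transposing), one
  of the twelve listed. This is a finite search; comparing the numbers of edges first keeps it
  short.
\<close>

lemma bipartite_matching_lists_complete:
  "\<forall>a b c d e f.
     \<exists>es \<in> set (filter (\<lambda>es. length es = 3 + length (filter id [a, b, c, d, e, f]))
                  bipartite_matching_lists).
     \<exists>p \<in> set perms3. \<exists>q \<in> set perms3.
       realises [[True, a, b], [c, True, d], [e, f, True]] es p q \<or>
       realises [[True, c, e], [a, True, f], [b, d, True]] es p q"
  by code_simp

lemma realises_imp_represents:
  fixes X Y :: "'a list"
  assumes M: "\<And>i j. i < 3 \<Longrightarrow> j < 3 \<Longrightarrow> M ! i ! j \<longleftrightarrow> {X ! i, Y ! j} \<in> edges G"
    and X: "\<And>i j. i < 3 \<Longrightarrow> j < 3 \<Longrightarrow> i \<noteq> j \<Longrightarrow> {X ! i, X ! j} \<notin> edges G"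
    and Y: "\<And>i j. i < 3 \<Longrightarrow> j < 3 \<Longrightarrow> i \<noteq> j \<Longrightarrow> {Y ! i, Y ! j} \<notin> edges G"
    and es: "es \<in> set bipartite_matching_lists" and pq: "p \<in> set perms3" "q \<in> set perms3"
    and real: "realises M es p q"
  shows "represents G (map ((!) X) p @ map ((!) Y) q) es" (is "represents G ?xs es")
proof -
  have len: "length p = 3" "length q = 3" and dist: "distinct p" "distinct q"
    and range: "set p = {0, 1, 2}" "set q = {0, 1, 2}"
    using pq by (auto simp: perms3_def)
  have p3: "p ! i < 3" and q3: "q ! i < 3" if "i < 3" for i
    using nth_mem[of i p] nth_mem[of i q] that len range by auto
  have left: "?xs ! i = X ! (p ! i)" and right: "?xs ! (i + 3) = Y ! (q ! i)" if "i < 3" for i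
    using that len by (auto simp: nth_append)
  have "{?xs ! i, ?xs ! j} \<in> edges G \<longleftrightarrow> (i, j) \<in> set es" if ij: "i < j" "j < 6" for i j
  proof -
    have no: "(i, j) \<notin> set es" if "j < 3 \<or> 3 \<le> i"
      using bipartite_matching_lists_between_sides[OF es, of i j] that by auto
    consider "j < 3" | k l where "i = k + 3" "j = l + 3" "k < l" "l < 3"
      | l where "i < 3" "j = l + 3" "l < 3"
    proof (cases "j < 3")
      case j: False
      show ?thesis
      proof (cases "i < 3")
        case True
        then show ?thesis using that(3)[of "j - 3"] ij j by simp
      next
        case False
        then show ?thesis using that(2)[of "i - 3" "j - 3"] ij j by simp
      qed
    qed (rule that)
    then show ?thesis
    proof cases
      case 1
      then have "p ! i \<noteq> p ! j" using dist len ij by (simp add: nth_eq_iff_index_eq)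
      then show ?thesis using 1 ij no X p3 left by simp
    next
      case 2
      then have "q ! k \<noteq> q ! l" using dist len by (simp add: nth_eq_iff_index_eq)
      then show ?thesis using 2 no Y q3 right by simp
    next
      case 3
      then have "i \<in> {0, 1, 2}" "l \<in> {0, 1, 2}" by auto
      then have "(i, l + 3) \<in> set es \<longleftrightarrow> M ! (p ! i) ! (q ! l)"
        using real unfolding realises_def by blast
      then show ?thesis using 3 M p3 q3 left right by simp
    qed
  qed
  then show ?thesis using len by (simp add: represents_def)
qed

text \<open>
  The edges between the two triples outside the matching are arbitrary: whatever they are, the six
  vertices induce one of \<open>H2\<close>, ..., \<open>H13\<close> by the classification above. These graphs enter the rest of
  the proof only through this lemma.
\<close>

lemma no_matched_bipartite:
  assumes simple: "simple_graph G" and free: "is_free_of forbidden_graphs G"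
    and V: "{x1, x2, x3, y1, y2, y3} \<subseteq> verts G" and dist: "distinct [x1, x2, x3, y1, y2, y3]"
    and x: "{x1, x2} \<notin> edges G" "{x1, x3} \<notin> edges G" "{x2, x3} \<notin> edges G"
    and y: "{y1, y2} \<notin> edges G" "{y1, y3} \<notin> edges G" "{y2, y3} \<notin> edges G"
    and xy: "{x1, y1} \<in> edges G" "{x2, y2} \<in> edges G" "{x3, y3} \<in> edges G"
  shows False
proof -
  let ?e = "\<lambda>u v. {u, v} \<in> edges G"
  let ?X = "[x1, x2, x3]" and ?Y = "[y1, y2, y3]"
  let ?M = "[[True, ?e x1 y2, ?e x1 y3], [?e x2 y1, True, ?e x2 y3], [?e x3 y1, ?e x3 y2, True]]"
  let ?T = "[[True, ?e x2 y1, ?e x3 y1], [?e x1 y2, True, ?e x3 y2], [?e x1 y3, ?e x2 y3, True]]"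
  have lt3: "i < 3 \<longleftrightarrow> i = 0 \<or> i = 1 \<or> i = 2" for i :: nat by auto
  have M: "?M ! i ! j \<longleftrightarrow> ?e (?X ! i) (?Y ! j)" and T: "?T ! i ! j \<longleftrightarrow> ?e (?Y ! i) (?X ! j)"
    if "i < 3" "j < 3" for i j
    using that xy unfolding lt3 by (auto simp: insert_commute)
  have X: "\<not> ?e (?X ! i) (?X ! j)" and Y: "\<not> ?e (?Y ! i) (?Y ! j)"
    if "i < 3" "j < 3" "i \<noteq> j" for i j
    using that x y unfolding lt3 by (auto simp: insert_commute)
  obtain es p q where es: "es \<in> set bipartite_matching_lists"
    and pq: "p \<in> set perms3" "q \<in> set perms3"
    and real: "realises ?M es p q \<or> realises ?T es p q"
    using bipartite_matching_lists_complete[rule_format, of "?e x1 y2" "?e x1 y3" "?e x2 y1"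
        "?e x2 y3" "?e x3 y1" "?e x3 y2"] unfolding set_filter by blast
  \<comment> \<open>The search finds the listed graph with either side of the given one in first place.\<close>
  have "represents G (map ((!) ?X) p @ map ((!) ?Y) q) es \<or>
        represents G (map ((!) ?Y) p @ map ((!) ?X) q) es"
    using real realises_imp_represents[where M = ?M and X = ?X and Y = ?Y, OF M X Y es pq]
      realises_imp_represents[where M = ?T and X = ?Y and Y = ?X, OF T Y X es pq]
    by blast
  moreover have "\<not> represents G (map ((!) A) p @ map ((!) B) q) es"
    if AB: "set A \<union> set B = {x1, x2, x3, y1, y2, y3}" "distinct (A @ B)" "length A = 3" "length B = 3"
    for A B
  proof (rule not_represents[OF simple free])
    have len: "length p = 3" "length q = 3" and dpq: "distinct p" "distinct q"
      and range: "set p = {..<3}" "set q = {..<3}"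
      using pq by (auto simp: perms3_def)
    have A: "set (map ((!) A) p) = set A" "distinct (map ((!) A) p)"
      unfolding set_map distinct_map range using AB dpq
      by (auto simp: in_set_conv_nth inj_on_nth)
    have B: "set (map ((!) B) q) = set B" "distinct (map ((!) B) q)"
      unfolding set_map distinct_map range using AB dpq
      by (auto simp: in_set_conv_nth inj_on_nth)
    show "distinct (map ((!) A) p @ map ((!) B) q)"
      using A B AB by (simp only: distinct_append)
    show "set (map ((!) A) p @ map ((!) B) q) \<subseteq> verts G"
      using A B AB V by (simp only: set_append) 
    show "length (map ((!) A) p @ map ((!) B) q) = 6" using len by simp
    show "edge_list_graph 6 es \<in> forbidden_graphs"
      using es by (simp add: forbidden_graphs_def bipartite_matching_graphs_eq)
    show "\<forall>(i, j)\<in>set es. i < j"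
      using bipartite_matching_lists_between_sides[OF es] by fastforce
  qed
  from this[of ?X ?Y] this[of ?Y ?X]
  have "\<not> represents G (map ((!) ?X) p @ map ((!) ?Y) q) es"
    "\<not> represents G (map ((!) ?Y) p @ map ((!) ?X) q) es"
    using dist by auto
  ultimately show False by blast
qed

lemma upt_numerals:
  "[0..<2] = [0, 1]" "[0..<3] = [0, 1, 2]" "[0..<4] = [0, 1, 2, 3]" "[0..<5] = [0, 1, 2, 3, 4]"
  "[0..<6] = [0, 1, 2, 3, 4, 5]" "[0..<7] = [0, 1, 2, 3, 4, 5, 6]"
  by (simp_all add: upt_rec)

lemma no_induced_C5:
  assumes simple: "simple_graph G" and free: "is_free_of forbidden_graphs G"
    and V: "{a, b, c, d, e} \<subseteq> verts G" and dist: "distinct [a, b, c, d, e]"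
    and edges: "{a, b} \<in> edges G" "{b, c} \<in> edges G" "{c, d} \<in> edges G" "{d, e} \<in> edges G"
      "{a, e} \<in> edges G"
    and non_edges: "{a, c} \<notin> edges G" "{a, d} \<notin> edges G" "{b, d} \<notin> edges G"
      "{b, e} \<notin> edges G" "{c, e} \<notin> edges G"
  shows False
proof -
  have "represents G [a, b, c, d, e] [(0,1), (1,2), (2,3), (3,4), (0,4)]"
    using edges non_edges by (simp add: represents_def upt_numerals del: set_upt)
  moreover have "H1 \<in> forbidden_graphs" by (simp add: forbidden_graphs_def)
  then have "\<not> represents G [a, b, c, d, e] [(0,1), (1,2), (2,3), (3,4), (0,4)]"
    unfolding H1_def by (rule not_represents[OF simple free]) (use V dist in auto)
  ultimately show False by blast
qed

lemma no_induced_H26: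
  assumes simple: "simple_graph G" and free: "is_free_of forbidden_graphs G"
    and V: "{a, b, c, d, e, f, g} \<subseteq> verts G" and dist: "distinct [a, b, c, d, e, f, g]"
    and edges: "{a, d} \<in> edges G" "{a, f} \<in> edges G" "{a, g} \<in> edges G" "{b, e} \<in> edges G"
      "{b, f} \<in> edges G" "{c, e} \<in> edges G" "{c, g} \<in> edges G" "{e, f} \<in> edges G"
      "{e, g} \<in> edges G" "{f, g} \<in> edges G"
    and non_edges: "{a, b} \<notin> edges G" "{a, c} \<notin> edges G" "{a, e} \<notin> edges G"
      "{b, c} \<notin> edges G" "{b, d} \<notin> edges G" "{b, g} \<notin> edges G" "{c, d} \<notin> edges G"
      "{c, f} \<notin> edges G" "{d, e} \<notin> edges G" "{d, f} \<notin> edges G" "{d, g} \<notin> edges G"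
  shows False
proof -
  let ?es = "[(0,3), (0,5), (0,6), (1,4), (1,5), (2,4), (2,6), (4,5), (4,6), (5,6)]"
  have "represents G [a, b, c, d, e, f, g] ?es"
    using edges non_edges by (simp add: represents_def upt_numerals del: set_upt)
  moreover have "H26 \<in> forbidden_graphs" by (simp add: forbidden_graphs_def)
  then have "\<not> represents G [a, b, c, d, e, f, g] ?es"
    unfolding H26_def by (rule not_represents[OF simple free]) (use V dist in auto)
  ultimately show False by blast
qed

section \<open>Matchings between maximum stable sets\<close>

text \<open>
  Hall's marriage theorem, by the usual induction on the index set. If some nonempty proper
  \<open>J \<subset> I\<close> is tight, then \<open>J\<close> and \<open>I - J\<close> are treated separately, the latter without the elements
  used up by \<open>J\<close>. Otherwise every nonempty proper subset has a surplus, and any choice for one index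
  leaves the condition intact for the others.
\<close>

lemma hall:
  fixes N :: "'i \<Rightarrow> 'b set"
  assumes "finite I" "\<forall>i\<in>I. finite (N i)"
    and "\<forall>J\<subseteq>I. card J \<le> card (\<Union>i\<in>J. N i)"
  shows "\<exists>f. inj_on f I \<and> (\<forall>i\<in>I. f i \<in> N i)"
  using assms
proof (induction I arbitrary: N rule: finite_psubset_induct)
  case (psubset I)
  have finU: "finite (\<Union>i\<in>J. N i)" if "J \<subseteq> I" for J
    using that psubset.hyps psubset.prems(1) by (auto intro: finite_subset)
  show ?case
  proof (cases "I = {}")
    case nonempty: False
    show ?thesis
    proof (cases "\<exists>J. J \<subset> I \<and> J \<noteq> {} \<and> card (\<Union>i\<in>J. N i) \<le> card J")
      case True
      then obtain J where J: "J \<subset> I" "J \<noteq> {}" "card (\<Union>i\<in>J. N i) \<le> card J" by blast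
      let ?NJ = "\<Union>i\<in>J. N i"
      have finI: "finite I" using psubset.hyps .
      have "\<exists>f. inj_on f J \<and> (\<forall>i\<in>J. f i \<in> N i)"
        using J psubset.prems by (intro psubset.IH) auto
      then obtain f where f: "inj_on f J" "\<forall>i\<in>J. f i \<in> N i" by blast
      have "\<exists>g. inj_on g (I - J) \<and> (\<forall>i\<in>I - J. g i \<in> N i - ?NJ)"
      proof (rule psubset.IH)
        show "I - J \<subset> I" using J by blast
        show "\<forall>i\<in>I - J. finite (N i - ?NJ)" using psubset.prems by blast
        show "\<forall>K\<subseteq>I - J. card K \<le> card (\<Union>i\<in>K. N i - ?NJ)"
        proof (intro allI impI)
          fix K assume K: "K \<subseteq> I - J"
          have fin: "finite K" "finite J" using K J finI by (auto intro: finite_subset)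
          have "card K + card J = card (K \<union> J)"
            using K fin by (intro card_Un_disjoint[symmetric]) auto
          also have "\<dots> \<le> card (\<Union>i\<in>K \<union> J. N i)"
            using K J psubset.prems(2) by blast
          also have "(\<Union>i\<in>K \<union> J. N i) = (\<Union>i\<in>K. N i - ?NJ) \<union> ?NJ" by blast
          also have "card \<dots> \<le> card (\<Union>i\<in>K. N i - ?NJ) + card ?NJ" by (rule card_Un_le)
          finally show "card K \<le> card (\<Union>i\<in>K. N i - ?NJ)" using J(3) by linarith
        qed
      qed
      then obtain g where g: "inj_on g (I - J)" "\<forall>i\<in>I - J. g i \<in> N i - ?NJ" by blast
      let ?h = "\<lambda>i. if i \<in> J then f i else g i"
      have "inj_on ?h I"
      proof (rule inj_onI)
        fix i j assume ij: "i \<in> I" "j \<in> I" "?h i = ?h j"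
        have cross: "f k \<noteq> g l" if "k \<in> J" "l \<in> I - J" for k l
        proof -
          have "f k \<in> ?NJ" "g l \<notin> ?NJ" using f(2) g(2) that by blast+
          then show ?thesis by metis
        qed
        show "i = j"
          using ij inj_onD[OF f(1), of i j] inj_onD[OF g(1), of i j] cross[of i j] cross[of j i]
          by (cases "i \<in> J"; cases "j \<in> J") auto
      qed
      moreover have "\<forall>i\<in>I. ?h i \<in> N i" using f(2) g(2) by simp
      ultimately show ?thesis by blast
    next
      case False
      then have surplus: "card J < card (\<Union>i\<in>J. N i)" if "J \<subset> I" "J \<noteq> {}" for J
        using that by (meson not_le)
      obtain i where i: "i \<in> I" using nonempty by blast
      have "card {i} \<le> card (N i)" using psubset.prems(2)[rule_format, of "{i}"] i by simp
      then have "N i \<noteq> {}" by auto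
      then obtain y where y: "y \<in> N i" by blast
      have "\<exists>f. inj_on f (I - {i}) \<and> (\<forall>j\<in>I - {i}. f j \<in> N j - {y})"
      proof (rule psubset.IH)
        show "I - {i} \<subset> I" using i by blast
        show "\<forall>j\<in>I - {i}. finite (N j - {y})" using psubset.prems by blast
        show "\<forall>J\<subseteq>I - {i}. card J \<le> card (\<Union>j\<in>J. N j - {y})"
        proof (intro allI impI)
          fix J assume J: "J \<subseteq> I - {i}"
          show "card J \<le> card (\<Union>j\<in>J. N j - {y})"
          proof (cases "J = {}")
            case False
            have "card J < card (\<Union>j\<in>J. N j)" using J i False by (intro surplus) auto
            also have "\<dots> \<le> card ((\<Union>j\<in>J. N j) - {y}) + 1"
              by (cases "y \<in> (\<Union>j\<in>J. N j)") (auto simp: card_Diff_singleton_if)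
            also have "(\<Union>j\<in>J. N j) - {y} = (\<Union>j\<in>J. N j - {y})" by blast
            finally show ?thesis by simp
          qed simp
        qed
      qed
      then obtain f where f: "inj_on f (I - {i})" "\<forall>j\<in>I - {i}. f j \<in> N j - {y}" by blast
      have "inj_on (f(i := y)) (insert i (I - {i}))"
        using f by (subst inj_on_insert) (auto intro: inj_on_fun_updI)
      then have "inj_on (f(i := y)) I" using i by (simp add: insert_absorb)
      moreover have "\<forall>j\<in>I. (f(i := y)) j \<in> N j" using f(2) y by simp
      ultimately show ?thesis by blast
    qed
  qed simp
qed

text \<open>
  If \<open>J \<subseteq> A - B\<close> had fewer than \<open>card J\<close> neighbours in \<open>B - A\<close>, then replacing these neighbours in
  \<open>B\<close> by \<open>J\<close> would give a larger stable set. This is Hall's condition.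
\<close>

lemma max_stable_matching:
  assumes G: "simple_graph G" and A: "max_stable G A" and B: "max_stable G B"
  shows "\<exists>f. inj_on f (A - B) \<and> (\<forall>a\<in>A - B. f a \<in> B - A \<and> {a, f a} \<in> edges G)"
proof -
  have fin: "finite (verts G)" using G by (simp add: simple_graph_def)
  have AB: "A \<subseteq> verts G" "B \<subseteq> verts G" using A B by (auto simp: max_stable_def)
  then have finAB: "finite A" "finite B" using fin by (auto intro: finite_subset)
  let ?N = "\<lambda>a. {b \<in> B - A. {a, b} \<in> edges G}"
  have "\<exists>f. inj_on f (A - B) \<and> (\<forall>a\<in>A - B. f a \<in> ?N a)"
  proof (rule hall)
    show "\<forall>J\<subseteq>A - B. card J \<le> card (\<Union>a\<in>J. ?N a)"
    proof (intro allI impI)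
      fix J assume J: "J \<subseteq> A - B"
      let ?NJ = "\<Union>a\<in>J. ?N a"
      have "finite J" using J finAB(1) by (auto intro: finite_subset)
      have NJ: "?NJ \<subseteq> B" by blast
      have 1: "{u, v} \<notin> edges G" if "u \<in> B - ?NJ" "v \<in> J" "u \<noteq> v" for u v
      proof (cases "u \<in> A")
        case True
        then show ?thesis using A that J by (auto simp: max_stable_def indep_def)
      next
        case False
        then show ?thesis using that by (auto simp: insert_commute)
      qed
      have 2: "{u, v} \<notin> edges G" if "u \<in> B" "v \<in> B" "u \<noteq> v" for u v
        using B that by (auto simp: max_stable_def indep_def)
      have 3: "{u, v} \<notin> edges G" if "u \<in> J" "v \<in> J" "u \<noteq> v" for u v
        using A that J by (auto simp: max_stable_def indep_def)
      have "indep (B - ?NJ \<union> J) (edges G)"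
        unfolding indep_def
      proof (intro ballI impI)
        fix u v assume "u \<in> B - ?NJ \<union> J" "v \<in> B - ?NJ \<union> J" "u \<noteq> v"
        then show "{u, v} \<notin> edges G"
          using 1[of u v] 1[of v u] 2[of u v] 3[of u v] unfolding insert_commute[of v u] by blast
      qed
      then have "card (B - ?NJ \<union> J) \<le> stability_number G"
        using AB J by (intro card_stable_le[OF fin]) auto
      also have "\<dots> = card B" using B by (simp add: max_stable_def)
      finally have "card (B - ?NJ) + card J \<le> card B"
        using J finAB \<open>finite J\<close> by (subst (asm) card_Un_disjoint) auto
      moreover have "card (B - ?NJ) = card B - card ?NJ" "card ?NJ \<le> card B"
        using NJ finAB by (auto intro: card_Diff_subset card_mono finite_subset)
      ultimately show "card J \<le> card ?NJ" by linarith
    qed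
  qed (use finAB in auto)
  then show ?thesis by auto
qed


section \<open>Critical graphs\<close>

text \<open>
  What a counterexample with fewest vertices satisfies. The locale is invariant under complement, so
  that every result about stable sets also holds for cliques.
\<close>

locale critical_graph =
  fixes G :: "'a graph"
  assumes simple: "simple_graph G"
    and free: "is_free_of forbidden_graphs G"
    and order: "card (verts G) = stability_number G + clique_number G + 1"
    and avoid_stable: "v \<in> verts G \<Longrightarrow> \<exists>S. max_stable G S \<and> v \<notin> S"
    and avoid_clique: "v \<in> verts G \<Longrightarrow> \<exists>K. max_clique G K \<and> v \<notin> K"

text \<open>
  In an induced subgraph with fewest vertices violating \<open>\<alpha> + \<omega> \<ge> n\<close>, deleting a vertex must restore the
  inequality, although \<open>n\<close> drops by only one and neither \<open>\<alpha>\<close> nor \<open>\<omega>\<close> increases. Hence \<open>n = \<alpha> + \<omega> + 1\<close>,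
  and \<open>\<alpha>\<close> and \<open>\<omega>\<close> are unchanged by the deletion: each vertex is avoided by some maximum stable set
  and by some maximum clique.
\<close>

lemma exists_critical_graph:
  assumes G: "simple_graph G" and free: "is_free_of forbidden_graphs G"
    and bad: "\<not> sum_perfect G"
  shows "\<exists>W \<subseteq> verts G. critical_graph (induced G W)"
proof -
  have finG: "finite (verts G)" using G by (simp add: simple_graph_def)
  let ?\<alpha> = "\<lambda>W. stability_number (induced G W)" and ?\<omega> = "\<lambda>W. clique_number (induced G W)"
  let ?bad = "\<lambda>W. W \<subseteq> verts G \<and> ?\<alpha> W + ?\<omega> W < card W"
  have "\<exists>W. ?bad W" using bad by (force simp: sum_perfect_def)
  then obtain W where W: "?bad W" and least: "\<And>U. ?bad U \<Longrightarrow> card W \<le> card U"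
    using ex_has_least_nat[of ?bad _ card] by metis
  have finW: "finite W" using W finG by (auto intro: finite_subset)
  have delete: "?\<alpha> (W - {v}) = ?\<alpha> W \<and> ?\<omega> (W - {v}) = ?\<omega> W \<and> card W = ?\<alpha> W + ?\<omega> W + 1"
    if v: "v \<in> W" for v
  proof -
    have "card (W - {v}) < card W" by (rule card_Diff1_less[OF finW v])
    then have "\<not> ?bad (W - {v})" using least[of "W - {v}"] by linarith
    then have "card (W - {v}) \<le> ?\<alpha> (W - {v}) + ?\<omega> (W - {v})" using W by auto
    moreover have "card (W - {v}) = card W - 1" using v by (simp add: card_Diff_singleton)
    moreover have "?\<alpha> (W - {v}) \<le> ?\<alpha> W" "?\<omega> (W - {v}) \<le> ?\<omega> W"
      using W finW by (auto intro: stability_number_induced_mono clique_number_induced_mono)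
    ultimately show ?thesis using W by linarith
  qed
  have "critical_graph (induced G W)"
  proof
    show "simple_graph (induced G W)" "is_free_of forbidden_graphs (induced G W)"
      using G W free by (auto intro: simple_graph_induced is_free_of_induced)
    have "W \<noteq> {}" using W by auto
    then show "card (verts (induced G W)) = ?\<alpha> W + ?\<omega> W + 1" using delete by auto
    fix v assume "v \<in> verts (induced G W)"
    then have v: "v \<in> W" by simp
    have stable: "indep S (edges (induced G (W - {v}))) \<longleftrightarrow> indep S (edges (induced G W))"
      and clique: "clique S (edges (induced G (W - {v}))) \<longleftrightarrow> clique S (edges (induced G W))"
      if "S \<subseteq> W - {v}" for S
      using that indep_induced_iff[of S _ G] clique_induced_iff[of S _ G] by blast+
    obtain S where "max_stable (induced G (W - {v})) S"
      using max_stable_exists[of "induced G (W - {v})"] finW by auto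
    then have "max_stable (induced G W) S \<and> v \<notin> S"
      using delete[OF v] stable by (auto simp: max_stable_def)
    then show "\<exists>S. max_stable (induced G W) S \<and> v \<notin> S" by blast
    obtain K where "max_clique (induced G (W - {v})) K"
      using max_clique_exists[of "induced G (W - {v})"] finW by auto
    then have "max_clique (induced G W) K \<and> v \<notin> K"
      using delete[OF v] clique by (auto simp: max_clique_def)
    then show "\<exists>K. max_clique (induced G W) K \<and> v \<notin> K" by blast
  qed
  then show ?thesis using W by blast
qed

context critical_graph
begin

lemma critical_complement: "critical_graph (complement G)"
  by unfold_locales
    (use simple free order avoid_stable avoid_clique in
      \<open>auto simp: simple_graph_complement is_free_of_forbidden_complement max_stable_complement
        max_clique_complement stability_number_complement clique_number_complement\<close>)

abbreviation adj :: "'a \<Rightarrow> 'a \<Rightarrow> bool" where "adj u v \<equiv> {u, v} \<in> edges G"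

lemma adj_commute: "adj u v \<longleftrightarrow> adj v u"
  by (simp add: insert_commute)

lemma not_adj_self: "\<not> adj v v"
  using simple by (auto simp: simple_graph_def nsets_def)

lemma finite_verts: "finite (verts G)"
  using simple by (simp add: simple_graph_def)

lemma max_stableD:
  assumes "max_stable G A"
  shows "A \<subseteq> verts G" "card A = stability_number G" "finite A"
    "u \<in> A \<Longrightarrow> v \<in> A \<Longrightarrow> \<not> adj u v"
proof -
  show "A \<subseteq> verts G" "card A = stability_number G" using assms by (auto simp: max_stable_def)
  then show "finite A" using finite_verts by (auto intro: finite_subset)
  show "u \<in> A \<Longrightarrow> v \<in> A \<Longrightarrow> \<not> adj u v"
    using assms not_adj_self by (cases "u = v") (auto simp: max_stable_def indep_def)
qed

lemma card_diff_max_stable: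
  assumes "max_stable G A" "max_stable G B"
  shows "card (A - B) = card (B - A)"
  using max_stableD[OF assms(1)] max_stableD[OF assms(2)]
  by (metis card_le_sym_Diff le_antisym order_refl)

text \<open>
  Three edges of the matching between \<open>A - B\<close> and \<open>B - A\<close> would span a forbidden bipartite graph.
\<close>

lemma max_stable_diff_le_two:
  assumes A: "max_stable G A" and B: "max_stable G B"
  shows "card (A - B) \<le> 2"
proof (rule ccontr)
  assume "\<not> card (A - B) \<le> 2"
  then have "3 \<le> card (A - B)" by simp
  then obtain X where X: "X \<subseteq> A - B" "card X = 3" by (meson obtain_subset_with_card_n)
  then obtain x1 x2 x3 where x: "X = {x1, x2, x3}" "distinct [x1, x2, x3]"
    by (auto simp: card_Suc_eq numeral_3_eq_3)
  obtain f where f: "inj_on f (A - B)" "\<forall>a\<in>A - B. f a \<in> B - A \<and> adj a (f a)"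
    using max_stable_matching[OF simple A B] by blast
  have xA: "{x1, x2, x3} \<subseteq> A - B" using X x by blast
  then have fB: "{f x1, f x2, f x3} \<subseteq> B - A" using f(2) by blast
  have "distinct [f x1, f x2, f x3]" using f(1) x(2) xA by (auto simp: inj_on_eq_iff)
  then have "distinct [x1, x2, x3, f x1, f x2, f x3]" using x(2) xA fB by auto
  moreover have "{x1, x2, x3, f x1, f x2, f x3} \<subseteq> verts G"
    using xA fB max_stableD(1)[OF A] max_stableD(1)[OF B] by blast
  moreover have "\<not> adj u v" if "u \<in> {x1, x2, x3}" "v \<in> {x1, x2, x3}" for u v
    using max_stableD(4)[OF A, of u v] that xA by blast
  moreover have "\<not> adj u v" if "u \<in> {f x1, f x2, f x3}" "v \<in> {f x1, f x2, f x3}" for u v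
    using max_stableD(4)[OF B, of u v] that fB by blast
  moreover have "adj x1 (f x1)" "adj x2 (f x2)" "adj x3 (f x3)" using f(2) xA by auto
  ultimately show False
    by (intro no_matched_bipartite[OF simple free, of x1 x2 x3 "f x1" "f x2" "f x3"]) simp_all
qed

text \<open>
  Suppose that any two maximum stable sets differ in at most one vertex. For \<open>a \<noteq> a'\<close> in a maximum
  stable set \<open>A\<close> take maximum stable sets \<open>B = A - a + b\<close> and \<open>C = A - a' + c\<close>. Then \<open>b\<close> is adjacent to
  \<open>a \<in> C\<close>, so \<open>b \<notin> C\<close>, and \<open>B - C\<close> contains both \<open>b\<close> and \<open>a'\<close>.
\<close>

lemma exists_max_stable_diff_two:
  assumes "stability_number G \<ge> 2"
  shows "\<exists>A B. max_stable G A \<and> max_stable G B \<and> card (A - B) = 2"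
proof (rule ccontr)
  assume contra: "\<not> ?thesis"
  have close: "card (A - B) \<le> 1" if "max_stable G A" "max_stable G B" for A B
    using max_stable_diff_le_two[OF that] contra that by (metis le_SucE numeral_2_eq_2 One_nat_def)
  obtain A where A: "max_stable G A" using max_stable_exists[OF finite_verts] by blast
  then have "2 \<le> card A" using assms max_stableD(2) by simp
  then obtain X where "X \<subseteq> A" "card X = 2" by (meson obtain_subset_with_card_n)
  then obtain a a' where a: "a \<in> A" "a' \<in> A" "a \<noteq> a'" by (auto simp: card_2_iff)
  have exchange: "\<exists>B b. max_stable G B \<and> A - B = {x} \<and> b \<in> B - A \<and> adj x b" if x: "x \<in> A" for x
  proof -
    obtain B where B: "max_stable G B" "x \<notin> B"
      using avoid_stable x max_stableD(1)[OF A] by blast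
    have "{x} = A - B"
      using close[OF A B(1)] x B(2) max_stableD(3)[OF A] by (intro card_seteq) auto
    moreover obtain f where "\<forall>a\<in>A - B. f a \<in> B - A \<and> adj a (f a)"
      using max_stable_matching[OF simple A B(1)] by blast
    ultimately show ?thesis using B(1) by blast
  qed
  obtain B b where B: "max_stable G B" "A - B = {a}" "b \<in> B - A" "adj a b"
    using exchange[OF a(1)] by blast
  obtain C where C: "max_stable G C" "A - C = {a'}" using exchange[OF a(2)] by blast
  have mem: "a \<notin> A - C" "a' \<notin> A - B" "a' \<in> A - C" using B(2) C(2) a(3) by simp_all
  then have "a \<in> C" using a(1) by simp
  then have "b \<notin> C" using max_stableD(4)[OF C(1)] B(4) by blast
  moreover have "a' \<in> B - C" using mem a(2) by simp
  ultimately have "{b, a'} \<subseteq> B - C" "b \<noteq> a'" using B(3) a by auto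
  moreover have "finite (B - C)" using max_stableD(3)[OF B(1)] by simp
  ultimately have "card {b, a'} \<le> card (B - C)" by (intro card_mono)
  with close[OF B(1) C(1)] \<open>b \<noteq> a'\<close> show False by simp
qed

section \<open>Private neighbours of a maximum stable set\<close>

text \<open>
  Each vertex \<open>x\<close> of the maximum stable set \<open>A\<close> has a neighbour \<open>p x\<close> with no other neighbour in \<open>A\<close>.
\<close>

definition private_neighbours :: "'a set \<Rightarrow> ('a \<Rightarrow> 'a) \<Rightarrow> bool" where
  "private_neighbours A p \<longleftrightarrow>
     max_stable G A \<and> (\<forall>x\<in>A. p x \<in> verts G - A \<and> (\<forall>y\<in>A. adj (p x) y \<longleftrightarrow> y = x))"

text \<open>
  The set with private neighbours is \<open>D + a + b'\<close>. The private neighbour of \<open>a\<close> is \<open>b\<close>, which has no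
  neighbour in \<open>D + b'\<close>; that of \<open>b'\<close> is \<open>a'\<close>; that of \<open>d \<in> D\<close> is the vertex \<open>e\<close> that replaces it, because
  \<open>e\<close> could otherwise be added to \<open>D + a + b'\<close>. Nonemptiness of \<open>D\<close> provides a stable set containing
  both \<open>a\<close> and \<open>b'\<close>, so that these two are not adjacent.
\<close>

lemma private_neighbours_of_exchange:
  assumes A: "max_stable G (D \<union> {a, a'})" and B: "max_stable G (D \<union> {b, b'})"
    and dist: "distinct [a, a', b, b']" "D \<inter> {a, a', b, b'} = {}"
    and ab: "adj a b" "adj a' b'"
    and C: "\<forall>d\<in>D. \<exists>e. e \<notin> D \<union> {a, a', b, b'} \<and> max_stable G (D - {d} \<union> {a, b', e})"
    and D: "D \<noteq> {}"
  shows "\<exists>A p. private_neighbours A p"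
proof -
  obtain e where e: "\<And>d. d \<in> D \<Longrightarrow> e d \<notin> D \<union> {a, a', b, b'}"
      "\<And>d. d \<in> D \<Longrightarrow> max_stable G (D - {d} \<union> {a, b', e d})"
    using bchoice[OF C] by blast
  let ?S = "D \<union> {a, b'}"
  have nD: "\<not> adj x y" if "x \<in> D \<union> {a, a'}" "y \<in> D \<union> {a, a'}" for x y
    using max_stableD(4)[OF A that] .
  have nB: "\<not> adj x y" if "x \<in> D \<union> {b, b'}" "y \<in> D \<union> {b, b'}" for x y
    using max_stableD(4)[OF B that] .
  have nC: "\<not> adj x y" if "d \<in> D" "x \<in> D - {d} \<union> {a, b', e d}" "y \<in> D - {d} \<union> {a, b', e d}" for d x y
    using max_stableD(4)[OF e(2)[OF that(1)] that(2,3)] .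
  have "\<not> adj a b'" using D nC[of _ a b'] by blast
  have finD: "finite D" using max_stableD(3)[OF A] by simp
  have nS: "\<not> adj x y" if "x \<in> ?S" "y \<in> ?S" for x y
    using that nD[of x y] nB[of x y] \<open>\<not> adj a b'\<close> adj_commute[of x y] by blast
  have V: "?S \<subseteq> verts G" "b \<in> verts G" "a' \<in> verts G"
    using max_stableD(1)[OF A] max_stableD(1)[OF B] by auto
  have "card ?S = card (D \<union> {a, a'})"
    using dist finD by (subst (1 2) card_Un_disjoint) auto
  then have S: "max_stable G ?S"
    using nS V(1) max_stableD(2)[OF A] by (auto simp: max_stable_def indep_def)
  have adj_e: "adj (e d) d" if d: "d \<in> D" for d
  proof (rule ccontr)
    assume no: "\<not> adj (e d) d"
    have "\<not> adj x y" if "x \<in> insert (e d) ?S" "y \<in> insert (e d) ?S" for x y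
    proof -
      have *: "\<not> adj (e d) z" if "z \<in> ?S" for z
        using that no nC[OF d, of "e d" z] by blast
      show ?thesis
        using that nS[of x y] *[of x] *[of y] adj_commute[of x y] not_adj_self[of "e d"] by blast
    qed
    then have "indep (insert (e d) ?S) (edges G)" by (auto simp: indep_def)
    moreover have "insert (e d) ?S \<subseteq> verts G"
      using V(1) max_stableD(1)[OF e(2)[OF d]] by blast
    ultimately have "card (insert (e d) ?S) \<le> stability_number G"
      by (intro card_stable_le finite_verts)
    moreover have "e d \<notin> ?S" using e(1)[OF d] by blast
    ultimately show False using max_stableD(2,3)[OF S] by simp
  qed
  let ?p = "\<lambda>x. if x = a then b else if x = b' then a' else e x"
  have "?p x \<in> verts G - ?S \<and> (\<forall>y\<in>?S. adj (?p x) y \<longleftrightarrow> y = x)" if x: "x \<in> ?S" for x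
  proof -
    consider "x = a" | "x = b'" | "x \<in> D" using x by blast
    then show ?thesis
    proof cases
      case 1
      have "adj b y \<longleftrightarrow> y = a" if "y \<in> ?S" for y
        using that ab(1) nB[of b y] adj_commute[of b a] by blast
      moreover have "b \<notin> ?S" using dist by auto
      ultimately show ?thesis using 1 V by simp
    next
      case 2
      have "adj a' y \<longleftrightarrow> y = b'" if "y \<in> ?S" for y
        using that ab(2) nD[of a' y] by blast
      moreover have "a' \<notin> ?S" "b' \<noteq> a" using dist by auto
      ultimately show ?thesis using 2 V by simp
    next
      case 3
      have "adj (e x) y \<longleftrightarrow> y = x" if "y \<in> ?S" for y
        using that adj_e[OF 3] nC[OF 3, of "e x" y] by blast
      moreover have "e x \<notin> ?S" "x \<noteq> a" "x \<noteq> b'" using e(1)[OF 3] dist 3 by auto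
      moreover have "e x \<in> verts G" using max_stableD(1)[OF e(2)[OF 3]] by blast
      ultimately show ?thesis by simp
    qed
  qed
  then show ?thesis
    using S unfolding private_neighbours_def by (intro exI[of _ ?S] exI[of _ ?p]) simp
qed

text \<open>
  Start from \<open>A = D + a + a'\<close> and \<open>B = D + b + b'\<close> differing in exactly two vertices, with edges \<open>a b\<close>
  and \<open>a' b'\<close>. For \<open>d \<in> D\<close> let \<open>C\<close> be a maximum stable set avoiding \<open>d\<close>. It misses at most one further
  vertex of \<open>A\<close> and one of \<open>B\<close>, and it contains at most one end of each of the two edges; so it contains
  exactly one of \<open>a, a'\<close> and, from the other edge, one of \<open>b, b'\<close>. Therefore \<open>C\<close> is \<open>D - d + a + b' + e\<close> or
  \<open>D - d + a' + b + e\<close> with a new vertex \<open>e\<close>. Sets of the two kinds for different \<open>d\<close> would differ in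
  three vertices, so one kind serves all of \<open>D\<close>.
\<close>

lemma exists_private_neighbours:
  assumes \<alpha>: "stability_number G \<ge> 3"
  shows "\<exists>A p. private_neighbours A p"
proof -
  obtain A B where A: "max_stable G A" and B: "max_stable G B" and AB: "card (A - B) = 2"
    using exists_max_stable_diff_two \<alpha> by auto
  obtain f where f: "inj_on f (A - B)" "\<forall>a\<in>A - B. f a \<in> B - A \<and> adj a (f a)"
    using max_stable_matching[OF simple A B] by blast
  obtain a a' where a: "A - B = {a, a'}" "a \<noteq> a'" using AB by (auto simp: card_2_iff)
  let ?b = "f a" and ?b' = "f a'"
  have ab: "adj a ?b" "adj a' ?b'" using f(2) a by auto
  have b_neq: "?b \<noteq> ?b'" using f(1) a by (auto simp: inj_on_eq_iff)
  have "card (B - A) = 2" using AB card_diff_max_stable[OF A B] by simp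
  moreover have "{?b, ?b'} \<subseteq> B - A" using f(2) a by auto
  ultimately have b: "B - A = {?b, ?b'}"
    using b_neq max_stableD(3)[OF B] by (intro card_subset_eq[symmetric]) auto
  define D where "D = A \<inter> B"
  have AD: "A = D \<union> {a, a'}" and BD: "B = D \<union> {?b, ?b'}" using a b unfolding D_def by blast+
  then have A': "max_stable G (D \<union> {a, a'})" and B': "max_stable G (D \<union> {?b, ?b'})"
    using A B by simp_all
  have dist: "distinct [a, a', ?b, ?b']" "D \<inter> {a, a', ?b, ?b'} = {}"
    using a b b_neq unfolding D_def by auto
  have "card A \<le> card D + card {a, a'}" using card_Un_le[of D "{a, a'}"] AD by simp
  then have "card D > 0" using a(2) \<alpha> max_stableD(2)[OF A] by simp
  then have D: "D \<noteq> {}" by auto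
  \<comment> \<open>\<open>e\<close> takes the place of \<open>d\<close> when \<open>D\<close> is completed by \<open>x\<close> and \<open>y\<close>.\<close>
  define swap where
    "swap x y d e \<longleftrightarrow> e \<notin> D \<union> {a, a', ?b, ?b'} \<and> max_stable G (D - {d} \<union> {x, y, e})"
    for x y d e
  have swap_exists: "(\<exists>e. swap a ?b' d e) \<or> (\<exists>e. swap a' ?b d e)" if d': "d \<in> D" for d
  proof -
    have d: "d \<in> A" "d \<in> B" using d' by (auto simp: D_def)
    obtain C where C: "max_stable G C" "d \<notin> C"
      using avoid_stable[of d] d max_stableD(1)[OF A] by blast
    have AC: "card (A - C) \<le> 2" and BC: "card (B - C) \<le> 2" and CA: "card (C - A) = card (A - C)"
      using max_stable_diff_le_two[OF A C(1)] max_stable_diff_le_two[OF B C(1)]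
        card_diff_max_stable[OF A C(1)] by simp_all
    have fin: "finite (A - C)" "finite (B - C)" using max_stableD(3) A B by auto
    have two: "X \<subseteq> {d, x}" if "card X \<le> 2" "finite X" "d \<in> X" "x \<in> X" "d \<noteq> x" for X x
    proof -
      have "{d, x} = X" using that by (intro card_seteq) auto
      then show ?thesis by simp
    qed
    have dX: "d \<in> A - C" "d \<in> B - C" using d C(2) by auto
    \<comment> \<open>The two kinds of \<open>C\<close> are symmetric: \<open>x, y\<close> are the vertices kept, \<open>x', y'\<close> those missed.\<close>
    have finish: "\<exists>e. swap x y d e"
      if xy: "A - B = {x, x'}" "B - A = {y', y}" "x \<noteq> x'" "y \<noteq> y'"
        and C': "x' \<notin> C" "y' \<notin> C" for x x' y y'
    proof -
      have "d \<noteq> x'" "d \<noteq> y'" using xy d by auto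
      then have sub: "A - C \<subseteq> {d, x'}" "B - C \<subseteq> {d, y'}"
        using two[OF AC fin(1) dX(1), of x'] two[OF BC fin(2) dX(2), of y'] xy C' by auto
      then have inC: "D - {d} \<subseteq> C" "x \<in> C" "y \<in> C" using xy d unfolding D_def by auto
      have "A - C = {d, x'}" using sub dX C' xy by auto
      then have "card (C - A) = 2" using CA \<open>d \<noteq> x'\<close> by simp
      moreover have "y \<in> C - A" using inC xy by auto
      ultimately have "card (C - A - {y}) = 1" by (simp add: card_Diff_singleton)
      then obtain e where "C - A - {y} = {e}" by (rule card_1_singletonE)
      then have e: "C - A = {y, e}" "e \<noteq> y" using \<open>y \<in> C - A\<close> by blast+
      have "C = D - {d} \<union> {x, y, e}"
        using inC e C' C(2) xy unfolding D_def by auto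
      moreover have "e \<notin> D \<union> {a, a', ?b, ?b'}"
        using e C'(2) a b xy unfolding D_def by auto
      ultimately show ?thesis using C(1) unfolding swap_def by (intro exI[of _ e]) simp
    qed
    have not_both: "\<not> (a \<in> C \<and> ?b \<in> C)" "\<not> (a' \<in> C \<and> ?b' \<in> C)"
      using ab max_stableD(4)[OF C(1)] by blast+
    have some: "a \<in> C \<or> a' \<in> C" "?b \<in> C \<or> ?b' \<in> C"
    proof -
      show "a \<in> C \<or> a' \<in> C"
        using two[OF AC fin(1) dX(1), of a] a d by blast
      have "y \<in> C \<or> y' \<in> C" if "B - A = {y, y'}" "y \<noteq> y'" for y y'
        using two[OF BC fin(2) dX(2), of y] that d by blast
      then show "?b \<in> C \<or> ?b' \<in> C" using b b_neq by simp
    qed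
    then consider "a' \<notin> C" "?b \<notin> C" | "a \<notin> C" "?b' \<notin> C" using not_both by blast
    then show ?thesis
    proof cases
      case 1
      then show ?thesis using finish[OF a(1) b a(2) b_neq[symmetric]] by simp
    next
      case 2
      have "A - B = {a', a}" "B - A = {?b', ?b}" using a(1) b by (simp_all add: insert_commute)
      then show ?thesis using finish[of a' a ?b' ?b] a(2) b_neq 2 by simp
    qed
  qed
  have consistent: False if "swap a ?b' d e" "swap a' ?b d' e'" "d \<in> D" "d' \<in> D" "d \<noteq> d'" for d d' e e'
  proof -
    let ?C = "D - {d} \<union> {a, ?b', e}" and ?C' = "D - {d'} \<union> {a', ?b, e'}"
    have C: "max_stable G ?C" "max_stable G ?C'" "e' \<notin> {a, ?b'}" "e' \<notin> D"
      using that by (auto simp: swap_def)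
    have "{d', a, ?b'} \<subseteq> ?C - ?C'" using C(3,4) that(3-5) dist by auto
    then have "card {d', a, ?b'} \<le> card (?C - ?C')"
      using max_stableD(3)[OF C(1)] by (intro card_mono) auto
    moreover have "d' \<noteq> a" "d' \<noteq> ?b'" using dist(2) that(4) by auto
    then have "card {d', a, ?b'} = 3" using dist(1) by simp
    ultimately show False using max_stable_diff_le_two[OF C(1,2)] by simp
  qed
  have "(\<forall>d\<in>D. \<exists>e. swap a ?b' d e) \<or> (\<forall>d\<in>D. \<exists>e. swap a' ?b d e)"
  proof (rule ccontr)
    assume "\<not> ?thesis"
    then obtain d d' where d: "d \<in> D" "\<nexists>e. swap a ?b' d e" and d': "d' \<in> D" "\<nexists>e. swap a' ?b d' e"
      by blast
    then obtain e e' where "swap a' ?b d e" "swap a ?b' d' e'" using swap_exists by blast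
    moreover have "d' \<noteq> d" using d d' swap_exists[of d] by blast
    ultimately show False using consistent d(1) d'(1) by blast
  qed
  then show ?thesis
  proof
    assume "\<forall>d\<in>D. \<exists>e. swap a ?b' d e"
    then show ?thesis
      unfolding swap_def by (rule private_neighbours_of_exchange[OF A' B' dist ab _ D])
  next
    have A'': "max_stable G (D \<union> {a', a})" and B'': "max_stable G (D \<union> {?b', ?b})"
      using A' B' by (simp_all add: insert_commute)
    have dist': "distinct [a', a, ?b', ?b]" "D \<inter> {a', a, ?b', ?b} = {}" using dist by auto
    assume "\<forall>d\<in>D. \<exists>e. swap a' ?b d e"
    then have "\<forall>d\<in>D. \<exists>e. e \<notin> D \<union> {a', a, ?b', ?b} \<and> max_stable G (D - {d} \<union> {a', ?b, e})"
      unfolding swap_def by (simp add: insert_commute)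
    then show ?thesis
      by (rule private_neighbours_of_exchange[OF A'' B'' dist' ab(2,1) _ D])
  qed
qed


lemma private_neighboursD:
  assumes "private_neighbours A p"
  shows "max_stable G A" "x \<in> A \<Longrightarrow> p x \<in> verts G" "x \<in> A \<Longrightarrow> p x \<notin> A"
    "x \<in> A \<Longrightarrow> y \<in> A \<Longrightarrow> adj (p x) y \<longleftrightarrow> y = x"
    "x \<in> A \<Longrightarrow> y \<in> A \<Longrightarrow> adj y (p x) \<longleftrightarrow> y = x"
    "x \<in> A \<Longrightarrow> y \<in> A \<Longrightarrow> p x = p y \<longleftrightarrow> x = y"
    "x \<in> A \<Longrightarrow> y \<in> A \<Longrightarrow> \<not> adj x y" "x \<in> A \<Longrightarrow> x \<in> verts G"
    "x \<in> A \<Longrightarrow> y \<in> A \<Longrightarrow> x \<noteq> p y"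
proof -
  show adj: "adj (p x) y \<longleftrightarrow> y = x" if "x \<in> A" "y \<in> A" for x y
    using assms that by (auto simp: private_neighbours_def)
  show "p x \<in> verts G" "p x \<notin> A" if "x \<in> A" for x
    using assms that by (auto simp: private_neighbours_def)
  then show "x \<noteq> p y" if "x \<in> A" "y \<in> A" for x y
    using that by blast
  show "adj y (p x) \<longleftrightarrow> y = x" if "x \<in> A" "y \<in> A" for x y
    using adj[OF that] adj_commute[of y "p x"] by simp
  show "p x = p y \<longleftrightarrow> x = y" if "x \<in> A" "y \<in> A" for x y
    using adj[OF that(1,1)] adj[OF that(2,1)] by metis
  show "max_stable G A" using assms by (simp add: private_neighbours_def)
  then show "\<not> adj x y" if "x \<in> A" "y \<in> A" for x y
    using that max_stableD(4) by blast
  show "x \<in> A \<Longrightarrow> x \<in> verts G" using \<open>max_stable G A\<close> max_stableD(1) by blast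
qed

text \<open>
  Take a third vertex \<open>r \<in> A\<close>. If \<open>p s, p t, p r\<close> do not form a triangle, they span a graph with at most
  two edges, hence bipartite, and the three pendant edges at \<open>s, t, r\<close> extend it to a bipartite graph
  whose perfect matching they form. In each case below the sides are obtained by exchanging some of
  the vertices \<open>x\<close> and \<open>p x\<close>.
\<close>

lemma private_neighbours_adjacent:
  assumes Ap: "private_neighbours A p" and \<alpha>: "stability_number G \<ge> 3"
    and st: "s \<in> A" "t \<in> A" "s \<noteq> t"
  shows "adj (p s) (p t)"
proof (rule ccontr)
  assume no: "\<not> adj (p s) (p t)"
  note P = private_neighboursD[OF Ap]
  have "card {s, t} < card A" using max_stableD(2)[OF P(1)] \<alpha> st by simp
  then have "\<not> A \<subseteq> {s, t}" using card_mono[of "{s, t}" A] by auto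
  then obtain r where r: "r \<in> A" "r \<noteq> s" "r \<noteq> t" by blast
  have V: "{s, t, r, p s, p t, p r} \<subseteq> verts G" and dist: "distinct [s, t, r, p s, p t, p r]"
    using P(2,6,8,9) st r by auto
  note bipartite = no_matched_bipartite[OF simple free]
  note facts = st r no P(4,5,7) adj_commute[of "p s" "p t"] adj_commute[of "p r" "p s"]
      adj_commute[of "p r" "p t"]
  consider "\<not> adj (p s) (p r)" "\<not> adj (p t) (p r)" | "adj (p s) (p r)" "\<not> adj (p t) (p r)"
    | "\<not> adj (p s) (p r)" "adj (p t) (p r)" | "adj (p s) (p r)" "adj (p t) (p r)" by blast
  then show False
  proof cases
    case 1
    then show False using bipartite[of s t r "p s" "p t" "p r"] V dist facts by auto
  next
    case 2
    then show False using bipartite[of "p s" t r s "p t" "p r"] V dist facts by auto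
  next
    case 3
    then show False using bipartite[of s "p t" r "p s" t "p r"] V dist facts by auto
  next
    case 4
    then show False using bipartite[of "p s" "p t" r s t "p r"] V dist facts by auto
  qed
qed

lemma private_neighbours_clique:
  assumes Ap: "private_neighbours A p" and \<alpha>: "stability_number G \<ge> 3"
  shows "clique (p ` A) (edges G)" "card (p ` A) = stability_number G" "p ` A \<subseteq> verts G"
    "A \<inter> p ` A = {}"
proof -
  note P = private_neighboursD[OF Ap]
  show "clique (p ` A) (edges G)"
    using private_neighbours_adjacent[OF Ap \<alpha>] by (auto simp: clique_def)
  show "card (p ` A) = stability_number G"
    using P(6) max_stableD(2)[OF P(1)] by (subst card_image) (auto simp: inj_on_def)
  show "p ` A \<subseteq> verts G" "A \<inter> p ` A = {}" using P(2,3) by auto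
qed

text \<open>
  The private neighbours form a clique of size \<open>\<alpha>\<close>.
\<close>

lemma stability_number_le_clique_number:
  assumes \<alpha>: "stability_number G \<ge> 3"
  shows "stability_number G \<le> clique_number G"
proof -
  obtain A p where Ap: "private_neighbours A p"
    using exists_private_neighbours[OF \<alpha>] by blast
  show ?thesis
    using card_clique_le[OF finite_verts private_neighbours_clique(3,1)[OF Ap \<alpha>]]
      private_neighbours_clique(2)[OF Ap \<alpha>] by simp
qed

section \<open>No critical graph exists\<close>

text \<open>
  Two maximum stable sets differing in two vertices are disjoint here, and one vertex \<open>w\<close> remains.
  Since neither triangles nor stable triples exist, every further adjacency is determined, up to
  symmetry, by an edge from \<open>w\<close> to one of the sets, and a pentagon results.
\<close>

lemma order_five_impossible:
  assumes \<alpha>: "stability_number G = 2" and \<omega>: "clique_number G = 2"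
  shows False
proof -
  obtain A B where A: "max_stable G A" and B: "max_stable G B" and AB: "card (A - B) = 2"
    using exists_max_stable_diff_two \<alpha> by auto
  obtain f where f: "\<forall>a\<in>A - B. f a \<in> B - A \<and> adj a (f a)" "inj_on f (A - B)"
    using max_stable_matching[OF simple A B] by blast
  have cA: "card A = 2" "finite A" and cB: "card B = 2" "finite B"
    using max_stableD(2,3)[OF A] max_stableD(2,3)[OF B] \<alpha> by auto
  have "A - B = A" using cA AB by (intro card_subset_eq) auto
  then have disj: "A \<inter> B = {}" by blast
  obtain a a' where a: "A = {a, a'}" "a \<noteq> a'" using cA by (auto simp: card_2_iff)
  define b b' where "b = f a" and "b' = f a'"
  have ab: "adj a b" "adj a' b'" "b \<in> B" "b' \<in> B" "b \<noteq> b'"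
    using f \<open>A - B = A\<close> a by (auto simp: b_def b'_def inj_on_eq_iff)
  then have Beq: "B = {b, b'}" using cB by (intro card_subset_eq[symmetric]) auto
  have AV: "A \<subseteq> verts G" and BV: "B \<subseteq> verts G" using max_stableD(1) A B by auto
  have "card (verts G - (A \<union> B)) = 1"
    using AV BV order \<alpha> \<omega> cA cB disj by (simp add: card_Diff_subset card_Un_disjoint)
  then obtain w where "verts G - (A \<union> B) = {w}" by (rule card_1_singletonE)
  then have w: "w \<in> verts G" "w \<notin> A" "w \<notin> B" by auto
  have dist: "distinct [w, a, b, a', b']" using a Beq ab disj w by auto
  have V: "{w, a, b, a', b'} \<subseteq> verts G" using w AV BV a Beq by auto
  have no_triangle: False if "adj x y" "adj x z" "adj y z" "distinct [x, y, z]" "{x, y, z} \<subseteq> verts G" for x y z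
  proof -
    have "clique {x, y, z} (edges G)" using that(1-3) by (auto simp: clique_def insert_commute)
    then show False using card_clique_le[OF finite_verts that(5)] that(4) \<omega> by simp
  qed
  have no_triple: False if "\<not> adj x y" "\<not> adj x z" "\<not> adj y z" "distinct [x, y, z]" "{x, y, z} \<subseteq> verts G" for x y z
  proof -
    have "indep {x, y, z} (edges G)" using that(1-3) by (auto simp: indep_def insert_commute)
    then show False using card_stable_le[OF finite_verts that(5)] that(4) \<alpha> by simp
  qed
  have naa: "\<not> adj a a'" and nbb: "\<not> adj b b'"
    using max_stableD(4)[OF A] max_stableD(4)[OF B] a Beq by auto
  have cycle: False
    if w: "adj w x" and xy: "adj x y" "adj x' y'" and n: "\<not> adj x x'" "\<not> adj y y'"
      and dist: "distinct [w, x, y, x', y']" and V: "{w, x, y, x', y'} \<subseteq> verts G" for x x' y y'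
  proof -
    have 1: "\<not> adj w y" using no_triangle[of w x y] that by auto
    have 2: "adj w y'" using no_triple[of w y y'] 1 n dist V by auto
    have 3: "\<not> adj w x'" using no_triangle[of w x' y'] 2 xy dist V by auto
    have 4: "adj x' y" using no_triple[of w x' y] 1 3 dist V by auto
    have 5: "\<not> adj x y'" using no_triangle[of w x y'] 2 w dist V by auto
    show False
      using no_induced_C5[OF simple free, of w x y x' y'] 1 2 3 4 5 w xy n dist V
        adj_commute[of x' y] by auto
  qed
  have "adj w a \<or> adj w a'" using no_triple[of w a a'] naa dist V by auto
  then show False
  proof
    assume "adj w a"
    then show False using cycle[of a b a' b'] ab naa nbb dist V by auto
  next
    assume "adj w a'"
    then show False
      using cycle[of a' b' a b] ab naa nbb dist V adj_commute[of a' a] adj_commute[of b' b] by auto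
  qed
qed

text \<open>
  Otherwise the graph is complete, so that \<open>\<omega> = n\<close>.
\<close>

lemma stability_number_ge_two: "stability_number G \<ge> 2"
proof (rule ccontr)
  assume "\<not> ?thesis"
  then have \<alpha>: "stability_number G \<le> 1" by simp
  have "adj u v" if "u \<in> verts G" "v \<in> verts G" "u \<noteq> v" for u v
  proof (rule ccontr)
    assume "\<not> adj u v"
    then have "indep {u, v} (edges G)" by (auto simp: indep_def insert_commute)
    then have "card {u, v} \<le> stability_number G"
      using that by (intro card_stable_le finite_verts) auto
    then show False using that \<alpha> by simp
  qed
  then have "clique (verts G) (edges G)" by (auto simp: clique_def)
  then have "card (verts G) \<le> clique_number G" by (intro card_clique_le finite_verts) auto
  then show False using order by simp
qed

text \<open>
  The graph consists of \<open>A\<close>, the clique \<open>p ` A\<close> and one more vertex \<open>v\<close>. A clique containing \<open>x \<in> A\<close> lies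
  in \<open>{x, p x, v}\<close> and is too small to be maximum. So a maximum clique avoiding \<open>p a\<close> consists of \<open>v\<close> and
  the rest of \<open>p ` A\<close>. Using this for every \<open>a\<close>, the vertex \<open>v\<close> is adjacent to all of \<open>p ` A\<close>, which gives a
  clique of size \<open>m + 1\<close>.
\<close>

lemma four_private_neighbours_impossible:
  assumes Ap: "private_neighbours A p" and m: "stability_number G = m" "clique_number G = m"
    and m4: "m \<ge> 4"
  shows False
proof -
  note P = private_neighboursD[OF Ap]
  have \<alpha>: "stability_number G \<ge> 3" using m m4 by simp
  note Q = private_neighbours_clique[OF Ap \<alpha>]
  have A: "A \<subseteq> verts G" "card A = m" "finite A" using max_stableD[OF P(1)] m by auto
  have finP: "finite (p ` A)" using A(3) by simp
  have "card (A \<union> p ` A) = 2 * m"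
    using A finP Q m by (simp add: card_Un_disjoint)
  then have "card (verts G - (A \<union> p ` A)) = 1"
    using A(1,3) finP Q(3) order m by (subst card_Diff_subset) auto
  then obtain v where v': "verts G - (A \<union> p ` A) = {v}" by (rule card_1_singletonE)
  then have v: "v \<in> verts G" "v \<notin> A" "v \<notin> p ` A" by auto
  have V: "verts G = insert v (A \<union> p ` A)" using v' A(1) Q(3) by blast
  have miss: "adj v (p y)" if a: "a \<in> A" and y: "y \<in> A" "y \<noteq> a" for a y
  proof -
    obtain L where L: "max_clique G L" "p a \<notin> L"
      using avoid_clique[OF P(2)[OF a]] by blast
    have LV: "L \<subseteq> verts G" and Lc: "clique L (edges G)" and cL: "card L = m"
      using L(1) m by (auto simp: max_clique_def)
    have LA: "x \<notin> L" if x: "x \<in> A" for x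
    proof
      assume xL: "x \<in> L"
      have "L \<subseteq> {x, p x, v}"
      proof
        fix z assume z: "z \<in> L"
        show "z \<in> {x, p x, v}"
        proof (cases "z = x")
          case False
          then have "adj x z" using Lc xL z by (auto simp: clique_def)
          then have "z \<notin> A" using P(7) x by blast
          moreover have "z = p x" if "z \<in> p ` A"
            using that \<open>adj x z\<close> P(5) x by auto
          ultimately show ?thesis using LV z V by blast
        qed simp
      qed
      then have "card L \<le> card {x, p x, v}" by (intro card_mono) auto
      also have "\<dots> \<le> 3" by (rule card_triple_le)
      finally show False using cL m4 by simp
    qed
    have "L \<subseteq> insert v (p ` A - {p a})" using LV V LA L(2) by blast
    moreover have "card (insert v (p ` A - {p a})) \<le> card L"
      using v(3) finP Q(2) a m cL m4 by (simp add: card_insert_if card_Diff_singleton)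
    ultimately have "L = insert v (p ` A - {p a})" using finP by (intro card_seteq) auto
    moreover have "p y \<noteq> p a" using P(6) a y by simp
    ultimately have "v \<in> L" "p y \<in> L" using y by auto
    moreover have "v \<noteq> p y" using v(3) y by blast
    ultimately show ?thesis using Lc by (auto simp: clique_def)
  qed
  have "adj v (p y)" if y: "y \<in> A" for y
  proof -
    have "card {y} < card A" using A m4 by simp
    then have "\<not> A \<subseteq> {y}" using card_mono[of "{y}" A] by auto
    then obtain a where "a \<in> A" "y \<noteq> a" by blast
    then show ?thesis using miss y by blast
  qed
  then have "clique (insert v (p ` A)) (edges G)"
    using Q(1) by (auto simp: clique_insert insert_commute)
  then have "card (insert v (p ` A)) \<le> clique_number G"
    using v Q(3) by (intro card_clique_le finite_verts) auto
  then show False using v(3) finP Q(2) m by simp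
qed

text \<open>
  Here \<open>A\<close> and \<open>p ` A\<close> form a net, a triangle with a pendant edge at each corner, and \<open>v\<close> is a seventh
  vertex. As there is no 4-clique, \<open>v\<close> misses some \<open>p c\<close>; as there is no stable set of size 4, \<open>v\<close> then has
  a neighbour in \<open>A - c\<close>. Excluding pentagons and matched bipartite graphs forces \<open>v\<close> to be adjacent to
  \<open>a, b, p a, p b\<close>, where \<open>A = {a, b, c}\<close>. Whether \<open>v\<close> is adjacent to \<open>c\<close> decides between the last two
  forbidden graphs, \<open>H26\<close> and its complement.
\<close>

lemma net_extension_impossible:
  assumes Ap: "private_neighbours A p" and \<alpha>: "stability_number G = 3" and \<omega>: "clique_number G = 3"
    and v: "v \<in> verts G" "v \<notin> A" "v \<notin> p ` A"
  shows False
proof -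
  note P = private_neighboursD[OF Ap]
  have \<alpha>3: "stability_number G \<ge> 3" using \<alpha> by simp
  note Q = private_neighbours_clique[OF Ap \<alpha>3]
  have A: "A \<subseteq> verts G" "card A = 3" "finite A" using max_stableD[OF P(1)] \<alpha> by auto
  have pp: "adj (p x) (p y)" if "x \<in> A" "y \<in> A" "x \<noteq> y" for x y
    using private_neighbours_adjacent[OF Ap \<alpha>3 that] .
  have clique: "\<exists>x\<in>A. \<not> adj v (p x)"
  proof (rule ccontr)
    assume "\<not> ?thesis"
    then have "clique (insert v (p ` A)) (edges G)"
      using Q(1) by (auto simp: clique_insert insert_commute)
    then have "card (insert v (p ` A)) \<le> clique_number G"
      using v Q(3) by (intro card_clique_le finite_verts) auto
    then show False using v(3) A(3) Q(2) \<alpha> \<omega> by simp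
  qed
  \<comment> \<open>Otherwise \<open>A - x\<close> together with \<open>p x\<close> and \<open>v\<close> is stable.\<close>
  have stable: "\<exists>y\<in>A. y \<noteq> x \<and> adj v y" if x: "x \<in> A" "\<not> adj v (p x)" for x
  proof (rule ccontr)
    assume no: "\<not> ?thesis"
    let ?S = "insert v (insert (p x) (A - {x}))"
    have "indep (A - {x}) (edges G)" using P(7) by (auto simp: indep_def)
    moreover have "\<forall>u\<in>A - {x}. \<not> adj u (p x)" using P(5) x by auto
    moreover have "\<forall>u\<in>insert (p x) (A - {x}). \<not> adj u v"
      using no x(2) adj_commute[of _ v] by auto
    ultimately have "indep ?S (edges G)" by (simp add: indep_insert)
    moreover have "?S \<subseteq> verts G" using v A(1) P(2) x by auto
    ultimately have "card ?S \<le> stability_number G" by (intro card_stable_le finite_verts)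
    moreover have "v \<noteq> p x" "p x \<notin> A" using v(3) x P(3) by auto
    ultimately show False using A v(2) x \<alpha> by (simp add: card_Diff_singleton)
  qed
  have distinct: "distinct [a, b, c, p a, p b, p c, v]"
    and V: "{a, b, c, p a, p b, p c, v} \<subseteq> verts G"
    if "a \<in> A" "b \<in> A" "c \<in> A" "distinct [a, b, c]" for a b c
    using that P(2,6,8,9) v by auto
  \<comment> \<open>The excluded matching is \<open>a (p a)\<close>, \<open>v b\<close>, \<open>(p c) c\<close>, between \<open>a, v, p c\<close> and \<open>p a, b, c\<close>.\<close>
  have both: "adj v a" if abc: "a \<in> A" "b \<in> A" "c \<in> A" "distinct [a, b, c]"
    and vb: "adj v b" and vc: "\<not> adj v (p c)" for a b c
  proof (rule ccontr)
    assume "\<not> adj v a"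
    then show False
      using no_matched_bipartite[OF simple free, of a v "p c" "p a" b c]
        distinct[OF abc] V[OF abc] abc vb vc P(4,5,7) pp adj_commute[of v a] by auto
  qed
  \<comment> \<open>A pentagon if \<open>v\<close> is adjacent to \<open>c\<close>, and otherwise the matching \<open>a v\<close>, \<open>b (p b)\<close>, \<open>(p c) c\<close>.\<close>
  have up: "adj v (p b)" if abc: "a \<in> A" "b \<in> A" "c \<in> A" "distinct [a, b, c]"
    and va: "adj v a" and vb: "adj v b" and vc: "\<not> adj v (p c)" for a b c
  proof (rule ccontr)
    assume no: "\<not> adj v (p b)"
    show False
    proof (cases "adj v c")
      case True
      show False
        using no_induced_C5[OF simple free, of v b "p b" "p c" c]
          distinct[OF abc] V[OF abc] abc vb vc no True P(4,5,7) pp by auto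
    next
      case False
      then show False
        using no_matched_bipartite[OF simple free, of a b "p c" v "p b" c]
          distinct[OF abc] V[OF abc] abc va vb vc no P(4,5,7) pp adj_commute[of v a] by auto
    qed
  qed
  obtain c where c: "c \<in> A" "\<not> adj v (p c)" using clique by blast
  obtain b where b: "b \<in> A" "b \<noteq> c" "adj v b" using stable[OF c] by blast
  have "card {b, c} < card A" using A b by simp
  then have "\<not> A \<subseteq> {b, c}" using card_mono[of "{b, c}" A] by auto
  then obtain a where a: "a \<in> A" "a \<noteq> b" "a \<noteq> c" by blast
  have abc: "a \<in> A" "b \<in> A" "c \<in> A" "distinct [a, b, c]" using a b c by auto
  have bac: "b \<in> A" "a \<in> A" "c \<in> A" "distinct [b, a, c]" using a b c by auto
  have va: "adj v a" using both[OF abc b(3) c(2)] .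
  have vpb: "adj v (p b)" using up[OF abc va b(3) c(2)] .
  have vpa: "adj v (p a)" using up[OF bac b(3) va c(2)] .
  note flip = adj_commute[of _ v]
  show False
  proof (cases "adj v c")
    case False
    then show False
      using no_induced_H26[OF simple free, of "p c" a b c v "p a" "p b"]
        distinct[OF abc] V[OF abc] abc va b(3) vpa vpb c(2) P(4,5,7) pp
        flip[of a] flip[of b] flip[of c] flip[of "p c"] by auto
  next
    case True
    interpret co: critical_graph "complement G" by (rule critical_complement)
    show False
      using no_induced_H26[OF co.simple co.free, of "p c" "p a" "p b" v c b a]
        distinct[OF abc] V[OF abc] abc va b(3) vpa vpb c(2) True P(4,5,7) pp
        flip[of a] flip[of b] flip[of c] flip[of "p a"] flip[of "p b"] flip[of "p c"]
      by (auto simp: edge_in_complement_iff)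
  qed
qed

lemma no_critical_graph: False
proof -
  interpret co: critical_graph "complement G" by (rule critical_complement)
  have \<alpha>2: "stability_number G \<ge> 2" and \<omega>2: "clique_number G \<ge> 2"
    using stability_number_ge_two co.stability_number_ge_two
    by (simp_all add: stability_number_complement)
  show False
  proof (cases "stability_number G \<ge> 3 \<or> clique_number G \<ge> 3")
    case False
    then show False using \<alpha>2 \<omega>2 order_five_impossible by linarith
  next
    case True
    have le: "stability_number G \<ge> 3 \<Longrightarrow> stability_number G \<le> clique_number G"
      "clique_number G \<ge> 3 \<Longrightarrow> clique_number G \<le> stability_number G"
      using stability_number_le_clique_number co.stability_number_le_clique_number
      by (simp_all add: stability_number_complement clique_number_complement)
    then have eq: "clique_number G = stability_number G" and \<alpha>: "stability_number G \<ge> 3"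
      using True by linarith+
    obtain A p where Ap: "private_neighbours A p"
      using exists_private_neighbours[OF \<alpha>] by blast
    show False
    proof (cases "stability_number G = 3")
      case False
      then show False
        using four_private_neighbours_impossible[OF Ap refl eq] \<alpha> by linarith
    next
      case three: True
      note Q = private_neighbours_clique[OF Ap \<alpha>]
      have "card (A \<union> p ` A) \<le> 6"
        using card_Un_le[of A "p ` A"] Q(2) max_stableD(2)[OF private_neighboursD(1)[OF Ap]] three
        by simp
      then have "\<not> verts G \<subseteq> A \<union> p ` A"
        using order eq three card_mono[of "A \<union> p ` A" "verts G"]
          max_stableD(3)[OF private_neighboursD(1)[OF Ap]] by auto
      then obtain v where "v \<in> verts G" "v \<notin> A" "v \<notin> p ` A" by blast
      then show False
        using net_extension_impossible[OF Ap three] eq three by simp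
    qed
  qed
qed

end

theorem theorem1p1:
  fixes G :: "'a graph"
  assumes "simple_graph G"
  shows "sum_perfect G \<longleftrightarrow> is_free_of forbidden_graphs G"
proof
  show "sum_perfect G \<Longrightarrow> is_free_of forbidden_graphs G"
    using assms by (rule sum_perfect_imp_free)
  assume free: "is_free_of forbidden_graphs G"
  show "sum_perfect G"
  proof (rule ccontr)
    assume "\<not> sum_perfect G"
    then obtain W where "critical_graph (induced G W)"
      using exists_critical_graph[OF assms free] by blast
    then show False by (rule critical_graph.no_critical_graph)
  qed
qed

end
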